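(* Fix $\sigma^2\ge0$, $L_H>0$, a probability distribution $\nu$ supported on an ellipsoid $\{\theta\in\mathbb{R}^d:\|A\theta\|_2=1\}$ ($A$ symmetric positive semi-definite) with $H=\mathbb{E}_\nu[\theta\theta^\top]$, and a symmetric positive semi-definite matrix $\Sigma_H$. Let $\mathcal{P}(\Sigma_H,L_H^2)$ be the set of covariate distributions for which $\tilde X=H^{1/2}X$ has covariance $\mathbb{E}[\tilde X\tilde X^\top]=\Sigma_H$ and $\mathbb{E}[\|\tilde X\|_2^2\,\tilde X\tilde X^\top]\preceq L_H^2\Sigma_H$. With $\lambda=\sigma^2/n$ and $\lambda_0=L_H^2/n$, $$(\lambda+\lambda_0)\,\mathrm{df}_1(\Sigma_H;\lambda+\lambda_0)-\lambda_0\,\mathrm{df}_1(\Sigma_H;\lambda_0)\le\sup_{\mathbb{P}\in\mathcal{P}(\Sigma_H,L_H^2)}\big\{\bar{\mathcal{E}}(\Sigma_H;\sigma^2)-\bar{\mathcal{E}}(\Sigma_H;0)\big\},$$ where inside the supremum the quantities are computed with covariate distribution $\mathbb{P}$.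
   Context: Setting: $(X,Y)\in\mathbb{R}^d\times\mathbb{R}$ satisfies $Y=X^\top\theta_\star+\epsilon$ with $\mathbb{E}[\epsilon\mid X]=0$, $\mathbb{E}[\epsilon^2\mid X]=\sigma^2$. Training data $(X_i,Y_i)_{i\in[n]}$ are i.i.d. copies of $(X,Y)$, independent of a test pair. A linear prediction rule is $\hat f(x)=\sum_{i=1}^n l_i(x)Y_i$ with each $l_i$ a (possibly random) function of $x$, $(X_i)_{i\in[n]}$ and independent randomness. $R(f)=\mathbb{E}[(Y-f(X))^2]$, $\mathcal{E}_{s}(\hat f)=\mathbb{E}[R(\hat f)]-s$ for noise variance $s$. $\bar{\mathcal{E}}(\Sigma_H;s)=\inf_{\hat f}\mathbb{E}_{\theta_\star\sim\nu}[\mathcal{E}_{s}(\hat f)]$ (infimum over linear prediction rules, $\theta_\star\sim\nu$ independent of the data), with $s=0$ meaning the noiseless model $\epsilon=0$. $\mathrm{df}_1(S;\lambda)=\mathrm{Tr}(S(S+\lambda I)^{-1})$.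
   Formalization: The set P(Σ_H, L_H²) is assumed nonempty; when it is empty (for example when Tr Σ_H > L_H²) the supremum is over the empty set and the stated inequality fails. *)

theory Defs
  imports "HOL-Probability.Probability"
begin

definition psd :: "real^'n^'n \<Rightarrow> bool" where
  "psd M \<longleftrightarrow> transpose M = M \<and> (\<forall>v. 0 \<le> v \<bullet> (M *v v))"

definition loewner_le :: "real^'n^'n \<Rightarrow> real^'n^'n \<Rightarrow> bool" where
  "loewner_le M1 M2 \<longleftrightarrow> psd (M2 - M1)"

definition msqrt :: "real^'n^'n \<Rightarrow> real^'n^'n" where
  "msqrt M = (THE S. psd S \<and> S ** S = M)"

definition second_moment :: "(real^'n) measure \<Rightarrow> real^'n^'n" where
  "second_moment Q = (\<chi> i j. \<integral>x. x$i * x$j \<partial>Q)"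

definition df1 :: "real^'n^'n \<Rightarrow> real \<Rightarrow> real" where
  "df1 S lam = trace (S ** matrix_inv (S + lam *\<^sub>R mat 1))"

definition cov_class :: "real^'n^'n \<Rightarrow> real^'n^'n \<Rightarrow> real \<Rightarrow> (real^'n) measure set" where
  "cov_class H SigmaH L2 = {P. prob_space P \<and> sets P = sets borel \<and>
     (\<forall>i j. integrable P (\<lambda>x. (msqrt H *v x)$i * (msqrt H *v x)$j)) \<and>
     (\<chi> i j. \<integral>x. (msqrt H *v x)$i * (msqrt H *v x)$j \<partial>P) = SigmaH \<and>
     (\<forall>i j. integrable P (\<lambda>x. (norm (msqrt H *v x))^2 * ((msqrt H *v x)$i * (msqrt H *v x)$j))) \<and>
     loewner_le (\<chi> i j. \<integral>x. (norm (msqrt H *v x))^2 * ((msqrt H *v x)$i * (msqrt H *v x)$j) \<partial>P)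
                (L2 *\<^sub>R SigmaH)}"

(* Conditional noise distribution of eps given X = x: E[eps|X]=0, E[eps^2|X]=s *)
definition noise_kernel :: "('a::topological_space \<Rightarrow> real measure) \<Rightarrow> real \<Rightarrow> bool" where
  "noise_kernel N s \<longleftrightarrow> N \<in> measurable borel (subprob_algebra borel) \<and>
     (\<forall>x. prob_space (N x) \<and> sets (N x) = sets borel \<and>
          integrable (N x) (\<lambda>e. e) \<and> integrable (N x) (\<lambda>e. e^2) \<and>
          (\<integral>e. e \<partial>N x) = 0 \<and> (\<integral>e. e^2 \<partial>N x) = s)"

(* A linear prediction rule  f(x) = sum_{i<n} l i x Xs u * Y_i, where u is independent
   randomness with law mu, Xs the training covariates. *)
definition linear_rule :: "nat \<Rightarrow> real measure \<Rightarrow>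
    (nat \<Rightarrow> real^'n \<Rightarrow> (nat \<Rightarrow> real^'n) \<Rightarrow> real \<Rightarrow> real) \<Rightarrow> bool" where
  "linear_rule n mu l \<longleftrightarrow> prob_space mu \<and> sets mu = sets borel \<and>
     (\<forall>i<n. (\<lambda>(x, Xs, u). l i x Xs u) \<in>
        borel_measurable (borel \<Otimes>\<^sub>M (PiM {..<n} (\<lambda>_. borel) \<Otimes>\<^sub>M mu)))"

(* E[R(f)] for fixed theta: expectation over training covariates Xs ~ P^n,
   training noises es_i ~ N(Xs i) independently, randomness u ~ mu,
   and an independent test pair (x, x.theta + e), x ~ P, e ~ N x. *)
definition expected_risk :: "nat \<Rightarrow> (real^'n) measure \<Rightarrow> (real^'n \<Rightarrow> real measure) \<Rightarrow>
    real measure \<Rightarrow> (nat \<Rightarrow> real^'n \<Rightarrow> (nat \<Rightarrow> real^'n) \<Rightarrow> real \<Rightarrow> real) \<Rightarrow> real^'n \<Rightarrow> ennreal" where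
  "expected_risk n P N mu l \<theta> =
     (\<integral>\<^sup>+ Xs. \<integral>\<^sup>+ es. \<integral>\<^sup>+ u. \<integral>\<^sup>+ x. \<integral>\<^sup>+ e.
        ennreal ((x \<bullet> \<theta> + e - (\<Sum>i<n. l i x Xs u * (Xs i \<bullet> \<theta> + es i)))^2)
      \<partial>N x \<partial>P \<partial>mu \<partial>PiM {..<n} (\<lambda>i. N (Xs i)) \<partial>PiM {..<n} (\<lambda>_. P))"

definition Ebar :: "nat \<Rightarrow> (real^'n) measure \<Rightarrow> (real^'n) measure \<Rightarrow> (real^'n \<Rightarrow> real measure) \<Rightarrow> real \<Rightarrow> ereal" where
  "Ebar n \<nu> P N s =
     enn2ereal (INF r \<in> {(mu, l). linear_rule n mu l}. \<integral>\<^sup>+ \<theta>. expected_risk n P N (fst r) (snd r) \<theta> \<partial>\<nu>)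
     - ereal s"

end

theory Submission
  imports Defs
begin

text \<open>Write \<open>R\<close> for the square root of \<open>H\<close>, \<open>s\<^sub>b\<close> for the eigenvalues of \<open>\<Sigma>\<^sub>H\<close> and \<open>b\<close> for the
  corresponding orthonormal eigenvectors. Averaging over the noise and over \<open>\<theta>\<close> turns the risk of a linear rule \<open>l\<close> into
  the expectation of \<open>\<parallel>R x - \<Sum>\<^sub>i l\<^sub>i R X\<^sub>i\<parallel>\<^sup>2 + \<sigma>\<^sup>2 \<Sum>\<^sub>i l\<^sub>i\<^sup>2 + \<sigma>\<^sup>2\<close>. Let \<open>R X\<close> take the value \<open>L b\<close> with
  probability \<open>s\<^sub>b / L\<^sup>2\<close> and \<open>0\<close> otherwise; this is possible since a nonempty class forces the trace of
  \<open>\<Sigma>\<^sub>H\<close> to be at most \<open>L\<^sup>2\<close> and the \<open>b\<close> with \<open>s\<^sub>b > 0\<close> to lie in the range of \<open>R\<close>. The problem then splits into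
  one-dimensional ridge problems: with \<open>T = \<Sum>\<^sub>i (b \<bullet> R X\<^sub>i)\<^sup>2\<close>, the gap between the noisy and the
  noiseless error is at least the sum over \<open>b\<close> of \<open>s\<^sub>b\<close> times the expectation of \<open>\<sigma>\<^sup>2 / (\<sigma>\<^sup>2 + T)\<close> on the event
  \<open>T > 0\<close>, which is bounded from below through the first two moments of \<open>T\<close>.\<close>

subsection \<open>Spectral decomposition and square roots of symmetric matrices\<close>

text \<open>The eigenvalue of \<open>b\<close> is recorded as its Rayleigh quotient
  \<open>b \<bullet> (M *v b)\<close>, so no separate eigenvalue function is carried along; a set of
  vectors copes with repeated eigenvalues.\<close>

definition eigenbasis :: "real^'n^'n \<Rightarrow> (real^'n) set \<Rightarrow> bool" where
  "eigenbasis M B \<longleftrightarrow> finite B \<and> pairwise orthogonal B \<and> (\<forall>b\<in>B. norm b = 1) \<and> span B = UNIV \<and>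
     (\<forall>b\<in>B. M *v b = (b \<bullet> (M *v b)) *\<^sub>R b)"

lemma symmetric_inner:
  fixes M :: "real^'n^'n"
  assumes "transpose M = M"
  shows "v \<bullet> (M *v w) = (M *v v) \<bullet> w"
  by (metis assms dot_lmul_matrix vector_transpose_matrix)

text \<open>First-order optimality without derivatives: near \<open>t = 0\<close> the quadratic term
  is negligible, so a nonzero slope would violate the bound. It serves both the maximum of a
  Rayleigh quotient and the zeros of a psd form.\<close>

lemma linear_le_quadratic_imp_zero:
  fixes a c :: real
  assumes "\<And>t. a * t \<le> c * t^2"
  shows "a = 0"
proof (rule ccontr)
  assume a: "a \<noteq> 0"
  define d where "d = \<bar>c\<bar> + 1"
  have d: "d > 0" "c < d" by (auto simp: d_def)
  have "a * (a / d) \<le> c * (a / d)^2" by (rule assms)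
  hence "a^2 * d \<le> c * a^2"
    using d by (simp add: power_divide field_simps power2_eq_square)
  moreover have "c * a^2 < d * a^2" using a d by simp
  ultimately show False by (simp add: mult.commute)
qed

text \<open>The first eigenvector is a maximiser of the Rayleigh quotient.\<close>

lemma exists_eigenvector:
  fixes M :: "real^'n^'n"
  assumes sym: "transpose M = M" and V: "subspace V" and inv: "\<And>v. v \<in> V \<Longrightarrow> M *v v \<in> V"
    and nz: "V \<noteq> {0}"
  obtains u where "u \<in> V" "norm u = 1" "M *v u = (u \<bullet> (M *v u)) *\<^sub>R u"
proof -
  let ?S = "V \<inter> sphere 0 1"
  obtain v where v: "v \<in> V" "v \<noteq> 0" using nz V subspace_0 by blast
  have "v /\<^sub>R norm v \<in> ?S" using v V by (auto simp: subspace_mul)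
  hence ne: "?S \<noteq> {}" by blast
  have "compact ?S" by (intro closed_Int_compact closed_subspace V) auto
  moreover have "continuous_on ?S (\<lambda>u. u \<bullet> (M *v u))"
    by (intro continuous_intros linear_continuous_on) (simp add: linear_conv_bounded_linear[symmetric])
  ultimately obtain u where u: "u \<in> ?S" and max: "\<And>y. y \<in> ?S \<Longrightarrow> y \<bullet> (M *v y) \<le> u \<bullet> (M *v u)"
    using continuous_attains_sup ne by meson
  define m where "m = u \<bullet> (M *v u)"
  have nu: "norm u = 1" "u \<in> V" "u \<bullet> u = 1" using u by (auto simp: dot_square_norm)
  \<comment> \<open>Homogeneity carries the maximum over the unit sphere to all of
    \<open>V\<close>.\<close>
  have quad: "y \<bullet> (M *v y) \<le> m * (y \<bullet> y)" if "y \<in> V" for y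
  proof (cases "y = 0")
    case False
    have "(y /\<^sub>R norm y) \<in> ?S" using that V False by (auto simp: subspace_mul)
    from max[OF this] have "(y \<bullet> (M *v y)) / (norm y)^2 \<le> m"
      by (simp add: m_def matrix_vector_mult_scaleR power2_eq_square divide_simps)
    thus ?thesis using False by (simp add: dot_square_norm divide_simps)
  qed simp
  have orth: "w \<bullet> (M *v u - m *\<^sub>R u) = 0" if w: "w \<in> V" for w
  proof -
    \<comment> \<open>This is \<open>quad\<close> at the perturbed point
      \<open>u + t *\<^sub>R w\<close> after the common terms cancel. The slope in \<open>t\<close>
      is the component of the residual \<open>M *v u - m *\<^sub>R u\<close> along
      \<open>w\<close>.\<close>
    have "2 * (w \<bullet> (M *v u - m *\<^sub>R u)) * t \<le> (m * (w \<bullet> w) - w \<bullet> (M *v w)) * t^2" for t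
    proof -
      have *: "u \<bullet> (M *v w) = w \<bullet> (M *v u)" by (metis symmetric_inner[OF sym] inner_commute)
      have "u + t *\<^sub>R w \<in> V" using w nu V by (simp add: subspace_add subspace_mul)
      from quad[OF this] show ?thesis
        by (simp add: matrix_vector_right_distrib matrix_vector_mult_scaleR inner_add inner_diff * nu(3)
              m_def[symmetric] inner_commute[of u w] algebra_simps power2_eq_square)
    qed
    from linear_le_quadratic_imp_zero[OF this] show ?thesis by simp
  qed
  have "M *v u - m *\<^sub>R u \<in> V" using inv nu V by (simp add: subspace_diff subspace_mul)
  from orth[OF this] have "M *v u = m *\<^sub>R u" by simp
  thus ?thesis using that nu m_def by blast
qed

text \<open>Induction on the dimension, which is why invariant subspaces appear instead of the whole
  space: after splitting off one eigenvector \<open>u\<close>, its orthogonal complement inside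
  \<open>V\<close> is again invariant because \<open>M\<close> is symmetric, and it has smaller
  dimension.\<close>

lemma eigenbasis_subspace:
  fixes M :: "real^'n^'n"
  assumes sym: "transpose M = M" and "subspace V" and "\<And>v. v \<in> V \<Longrightarrow> M *v v \<in> V"
  shows "\<exists>B. finite B \<and> pairwise orthogonal B \<and> (\<forall>b\<in>B. norm b = 1) \<and> span B = V \<and>
     (\<forall>b\<in>B. M *v b = (b \<bullet> (M *v b)) *\<^sub>R b)"
  using assms(2,3)
proof (induction "dim V" arbitrary: V rule: less_induct)
  case less
  show ?case
  proof (cases "V = {0}")
    case True thus ?thesis by (intro exI[of _ "{}"]) auto
  next
    case False
    obtain u where u: "u \<in> V" "norm u = 1" "M *v u = (u \<bullet> (M *v u)) *\<^sub>R u"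
      using exists_eigenvector[OF sym less.prems(1) less.prems(2) False] by metis
    have uu: "u \<bullet> u = 1" using u by (simp add: dot_square_norm)
    define W where "W = V \<inter> {w. u \<bullet> w = 0}"
    have W: "subspace W" unfolding W_def
      by (intro subspace_inter less.prems) (simp add: subspace_hyperplane)
    have inv: "M *v w \<in> W" if "w \<in> W" for w
    proof -
      have "u \<bullet> (M *v w) = (u \<bullet> (M *v u)) * (u \<bullet> w)"
        unfolding symmetric_inner[OF sym, of u w] by (subst u(3)) simp
      thus ?thesis using that less.prems(2) by (auto simp: W_def)
    qed
    have "u \<notin> W" using uu by (auto simp: W_def)
    hence "W \<subset> V" using u(1) unfolding W_def by blast
    hence "dim W < dim V" using W less.prems(1)
      by (metis dim_psubset span_eq_iff)
    from less.hyps[OF this W inv] obtain B where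
      B: "finite B" "pairwise orthogonal B" "\<forall>b\<in>B. norm b = 1" "span B = W"
         "\<forall>b\<in>B. M *v b = (b \<bullet> (M *v b)) *\<^sub>R b" by blast
    have BW: "B \<subseteq> W" using B(4) span_superset by blast
    have po: "pairwise orthogonal (insert u B)"
      using B(2) BW by (auto simp: pairwise_insert orthogonal_def W_def inner_commute)
    have sp: "span (insert u B) = V"
    proof
      show "span (insert u B) \<subseteq> V" using BW u by (intro span_minimal less.prems) (auto simp: W_def)
      show "V \<subseteq> span (insert u B)"
      proof
        fix v assume v: "v \<in> V"
        have "v - (u \<bullet> v) *\<^sub>R u \<in> W"
          using v u less.prems(1) by (auto simp: W_def subspace_diff subspace_mul inner_diff uu)
        thus "v \<in> span (insert u B)" unfolding span_insert B(4) by blast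
      qed
    qed
    show ?thesis using B u po sp by (intro exI[of _ "insert u B"]) auto
  qed
qed

lemma eigenbasis_exists:
  fixes M :: "real^'n^'n"
  assumes "transpose M = M"
  obtains B where "eigenbasis M B"
  using eigenbasis_subspace[OF assms, of UNIV] unfolding eigenbasis_def by auto

section \<open>Coordinates, trace and degrees of freedom in an eigenbasis\<close>

lemma eigenbasis_inner:
  assumes "eigenbasis M B" "a \<in> B" "b \<in> B"
  shows "a \<bullet> b = (if a = b then 1 else 0)"
  using assms unfolding eigenbasis_def pairwise_def orthogonal_def by (auto simp: dot_square_norm)

lemma eigenbasis_expand:
  assumes "eigenbasis M B"
  shows "(\<Sum>b\<in>B. (x \<bullet> b) *\<^sub>R b) = x"
  using assms unfolding eigenbasis_def by (intro orthonormal_basis_expand) auto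

lemma eigenbasis_apply:
  assumes "eigenbasis M B"
  shows "M *v x = (\<Sum>b\<in>B. (b \<bullet> (M *v b)) *\<^sub>R (x \<bullet> b) *\<^sub>R b)"
proof -
  have "M *v x = M *v (\<Sum>b\<in>B. (x \<bullet> b) *\<^sub>R b)" by (simp add: eigenbasis_expand[OF assms])
  also have "\<dots> = (\<Sum>b\<in>B. (x \<bullet> b) *\<^sub>R (M *v b))"
    by (simp add: linear_sum[OF matrix_vector_mul_linear] matrix_vector_mult_scaleR)
  also have "\<dots> = (\<Sum>b\<in>B. (b \<bullet> (M *v b)) *\<^sub>R (x \<bullet> b) *\<^sub>R b)"
    using assms unfolding eigenbasis_def by (intro sum.cong) (auto, metis scaleR_scaleR mult.commute)
  finally show ?thesis .
qed

text \<open>Basis independence of the trace: expand the coordinate vectors in \<open>B\<close> and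
  swap the sums. \<open>K\<close> need not be diagonal in \<open>B\<close>.\<close>

lemma trace_eigenbasis:
  fixes M K :: "real^'n^'n"
  assumes "eigenbasis M B"
  shows "trace K = (\<Sum>b\<in>B. b \<bullet> (K *v b))"
proof -
  have "trace K = (\<Sum>i\<in>UNIV. (K *v axis i 1) $ i)"
    by (simp add: trace_def matrix_vector_mult_basis column_def)
  also have "\<dots> = (\<Sum>i\<in>UNIV. \<Sum>b\<in>B. b $ i * (K *v b) $ i)"
  proof (rule sum.cong)
    fix i
    have "K *v axis i 1 = K *v (\<Sum>b\<in>B. (axis i 1 \<bullet> b) *\<^sub>R b)"
      by (simp add: eigenbasis_expand[OF assms])
    also have "\<dots> = (\<Sum>b\<in>B. b $ i *\<^sub>R (K *v b))"
      by (simp add: linear_sum[OF matrix_vector_mul_linear] matrix_vector_mult_scaleR inner_axis')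
    finally show "(K *v axis i 1) $ i = (\<Sum>b\<in>B. b $ i * (K *v b) $ i)" by simp
  qed simp
  also have "\<dots> = (\<Sum>b\<in>B. b \<bullet> (K *v b))"
    by (subst sum.swap) (simp add: inner_vec_def)
  finally show ?thesis .
qed

text \<open>On an eigenvector with eigenvalue \<open>s\<close> the resolvent acts as division by
  \<open>s + t\<close>. Since \<open>t > 0\<close>, the matrix \<open>S + t *\<^sub>R mat 1\<close>
  has trivial kernel, and this invertibility is what gives the choice operator in
  \<open>matrix_inv\<close> its meaning.\<close>

lemma df1_eigenbasis:
  fixes S :: "real^'n^'n"
  assumes "psd S" and B: "eigenbasis S B" and t: "t > 0"
  shows "df1 S t = (\<Sum>b\<in>B. (b \<bullet> (S *v b)) / ((b \<bullet> (S *v b)) + t))"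
proof -
  let ?K = "S + t *\<^sub>R mat 1 :: real^'n^'n"
  have K: "?K *v v = S *v v + t *\<^sub>R v" for v
    by (simp add: matrix_vector_mult_add_rdistrib scaleR_matrix_vector_assoc[symmetric])
  have "v = 0" if "?K *v v = 0" for v
  proof -
    have "v \<bullet> (S *v v) + t * (v \<bullet> v) = 0" using that K[of v] by (metis inner_add_right inner_scaleR_right inner_zero_right)
    moreover have "v \<bullet> (S *v v) \<ge> 0" using assms(1) by (auto simp: psd_def)
    moreover have "t * (v \<bullet> v) \<ge> 0" using t by simp
    ultimately have "t * (v \<bullet> v) = 0" by linarith
    thus ?thesis using t by simp
  qed
  hence "invertible ?K"
    by (simp add: invertible_left_inverse matrix_left_invertible_ker)
  hence inv: "matrix_inv ?K ** ?K = mat 1"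
    unfolding invertible_def matrix_inv_def by (rule someI2_ex) simp
  have "trace (S ** matrix_inv ?K) = (\<Sum>b\<in>B. b \<bullet> ((S ** matrix_inv ?K) *v b))"
    by (rule trace_eigenbasis[OF B])
  also have "\<dots> = (\<Sum>b\<in>B. (b \<bullet> (S *v b)) / ((b \<bullet> (S *v b)) + t))"
  proof (rule sum.cong)
    fix b assume b: "b \<in> B"
    define s where "s = b \<bullet> (S *v b)"
    have s: "S *v b = s *\<^sub>R b" "s \<ge> 0" using b B assms(1) by (auto simp: s_def eigenbasis_def psd_def)
    have "?K *v b = (s + t) *\<^sub>R b" unfolding K s by (simp add: scaleR_add_left)
    hence "matrix_inv ?K *v ((s + t) *\<^sub>R b) = b"
      using inv by (metis matrix_vector_mul_assoc matrix_vector_mul_lid)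
    hence "(s + t) *\<^sub>R (matrix_inv ?K *v b) = b" by (simp add: matrix_vector_mult_scaleR)
    moreover have "s + t \<noteq> 0" using s(2) t by linarith
    hence "matrix_inv ?K *v b = (1 / (s + t)) *\<^sub>R ((s + t) *\<^sub>R (matrix_inv ?K *v b))" by simp
    ultimately have "matrix_inv ?K *v b = (1 / (s + t)) *\<^sub>R b" by simp
    hence "(S ** matrix_inv ?K) *v b = (s / (s + t)) *\<^sub>R b"
      by (simp add: matrix_vector_mul_assoc[symmetric] matrix_vector_mult_scaleR s)
    thus "b \<bullet> ((S ** matrix_inv ?K) *v b) = (b \<bullet> (S *v b)) / ((b \<bullet> (S *v b)) + t)"
      using eigenbasis_inner[OF B b b] by (simp add: s_def[symmetric])
  qed simp
  finally show ?thesis unfolding df1_def .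
qed

section \<open>Existence and uniqueness of the psd square root\<close>

lemma psd_zero_form:
  fixes S :: "real^'n^'n"
  assumes S: "psd S" and z: "v \<bullet> (S *v v) = 0"
  shows "S *v v = 0"
proof -
  have sym: "transpose S = S" using S by (simp add: psd_def)
  \<comment> \<open>The form is nonnegative at \<open>v + t *\<^sub>R (S *v v)\<close>; as it
    vanishes at \<open>v\<close>, the linear term in \<open>t\<close> must vanish too, and its
    coefficient is twice the squared norm of \<open>S *v v\<close>.\<close>
  have "-(2 * ((S *v v) \<bullet> (S *v v))) * t \<le> ((S *v v) \<bullet> (S *v (S *v v))) * t^2" for t
  proof -
    have "0 \<le> (v + t *\<^sub>R (S *v v)) \<bullet> (S *v (v + t *\<^sub>R (S *v v)))" using S by (simp add: psd_def)
    thus ?thesis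
      by (simp add: matrix_vector_right_distrib matrix_vector_mult_scaleR inner_add z
            symmetric_inner[OF sym, of v "S *v v"] algebra_simps power2_eq_square)
  qed
  from linear_le_quadratic_imp_zero[OF this] show ?thesis by simp
qed

text \<open>Take an eigenvector \<open>b\<close> of \<open>S - T\<close> with eigenvalue
  \<open>m\<close>. Equal squares give \<open>S *v b\<close> and \<open>T *v b\<close> the same
  norm, and the difference of the squared norms is \<open>m\<close> times the sum of the two forms
  at \<open>b\<close>. If \<open>m\<close> were nonzero, both forms would vanish, hence both images
  of \<open>b\<close>, contradicting \<open>S *v b = T *v b + m *\<^sub>R b\<close>.\<close>

lemma psd_sqrt_unique:
  fixes S T :: "real^'n^'n"
  assumes S: "psd S" and T: "psd T" and eq: "S ** S = T ** T"
  shows "S = T"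
proof -
  have sym: "transpose (S - T) = S - T" using S T by (simp add: psd_def transpose_def vec_eq_iff)
  have symS: "transpose S = S" "transpose T = T" using S T by (auto simp: psd_def)
  obtain B where B: "eigenbasis (S - T) B" using eigenbasis_exists[OF sym] .
  have "b \<bullet> ((S - T) *v b) = 0" if b: "b \<in> B" for b
  proof (rule ccontr)
    define m where "m = b \<bullet> ((S - T) *v b)"
    assume "b \<bullet> ((S - T) *v b) \<noteq> 0"
    hence m: "m \<noteq> 0" by (simp add: m_def)
    have D: "S *v b = T *v b + m *\<^sub>R b"
    proof -
      have "(S - T) *v b = m *\<^sub>R b" using b B by (simp add: eigenbasis_def m_def)
      thus ?thesis by (simp add: matrix_vector_mult_diff_rdistrib algebra_simps)
    qed
    have "b \<bullet> (S *v (S *v b)) = b \<bullet> (T *v (T *v b))"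
      by (simp add: matrix_vector_mul_assoc eq)
    hence "m * (b \<bullet> (S *v b) + b \<bullet> (T *v b)) = 0"
      unfolding symmetric_inner[OF symS(1), of b "S *v b"] symmetric_inner[OF symS(2), of b "T *v b"]
      by (simp add: D inner_add algebra_simps inner_commute)
    hence "b \<bullet> (S *v b) + b \<bullet> (T *v b) = 0" using m by simp
    moreover have "b \<bullet> (S *v b) \<ge> 0" "b \<bullet> (T *v b) \<ge> 0" using S T by (auto simp: psd_def)
    ultimately have "b \<bullet> (S *v b) = 0" "b \<bullet> (T *v b) = 0" by linarith+
    hence "S *v b = 0" "T *v b = 0" using psd_zero_form S T by blast+
    thus False using D m eigenbasis_inner[OF B b b] by auto
  qed
  hence "(S - T) *v x = 0" for x by (subst eigenbasis_apply[OF B]) simp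
  thus ?thesis by (simp add: matrix_eq matrix_vector_mult_diff_rdistrib)
qed

lemma psd_sqrt_exists:
  fixes M :: "real^'n^'n"
  assumes M: "psd M"
  shows "\<exists>S. psd S \<and> S ** S = M"
proof -
  obtain B where B: "eigenbasis M B" using M eigenbasis_exists psd_def by blast
  define r where "r b = sqrt (b \<bullet> (M *v b))" for b
  have r: "r b ^ 2 = b \<bullet> (M *v b)" "r b \<ge> 0" for b using M by (auto simp: r_def psd_def)
  define S where "S = matrix (\<lambda>x. \<Sum>b\<in>B. r b *\<^sub>R (x \<bullet> b) *\<^sub>R b)"
  have lin: "linear (\<lambda>x. \<Sum>b\<in>B. r b *\<^sub>R (x \<bullet> b) *\<^sub>R b)"
    by (intro linearI) (simp_all add: inner_add_left algebra_simps sum.distrib scaleR_sum_right)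
  have S: "S *v x = (\<Sum>b\<in>B. r b *\<^sub>R (x \<bullet> b) *\<^sub>R b)" for x
    unfolding S_def by (rule fun_cong[OF matrix_vector_mul(2)[OF lin]])
  have Sb: "(S *v x) \<bullet> b = r b * (x \<bullet> b)" if b: "b \<in> B" for x b
  proof -
    have "(S *v x) \<bullet> b = (\<Sum>a\<in>B. r a * (x \<bullet> a) * (a \<bullet> b))" by (simp add: S inner_sum_left mult.assoc)
    also have "\<dots> = (\<Sum>a\<in>B. if a = b then r a * (x \<bullet> a) else 0)"
      by (intro sum.cong) (auto simp: eigenbasis_inner[OF B _ b])
    also have "\<dots> = r b * (x \<bullet> b)" using b B by (simp add: eigenbasis_def)
    finally show ?thesis .
  qed
  have "S *v (S *v x) = M *v x" for x
    unfolding eigenbasis_apply[OF B, of x]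
    by (subst S) (auto intro!: sum.cong simp: Sb r(1)[symmetric] power2_eq_square)
  hence "S ** S = M" by (simp add: matrix_eq matrix_vector_mul_assoc[symmetric])
  moreover have "transpose S = S"
  proof -
    have "S $ i $ j = axis i 1 \<bullet> (S *v axis j 1)" for i j
      by (simp add: matrix_vector_mult_basis column_def inner_axis')
    hence "S $ i $ j = S $ j $ i" for i j
      by (simp add: S inner_sum_right inner_axis' inner_axis mult.commute mult.left_commute)
    thus ?thesis by (simp add: transpose_def vec_eq_iff)
  qed
  moreover have "v \<bullet> (S *v v) = (\<Sum>b\<in>B. r b * (v \<bullet> b)^2)" for v
    by (simp add: S inner_sum_right power2_eq_square mult.assoc)
  hence "v \<bullet> (S *v v) \<ge> 0" for v using r by (simp add: sum_nonneg)
  ultimately show ?thesis by (auto simp: psd_def)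
qed

lemma msqrt_psd:
  fixes M :: "real^'n^'n"
  assumes "psd M"
  shows "psd (msqrt M)" "msqrt M ** msqrt M = M"
proof -
  have "\<exists>!S. psd S \<and> S ** S = M" using psd_sqrt_exists[OF assms] psd_sqrt_unique by metis
  from theI'[OF this] show "psd (msqrt M)" "msqrt M ** msqrt M = M" unfolding msqrt_def by auto
qed

subsection \<open>The risk averaged over noise and parameter\<close>

lemma moment_form:
  fixes y :: "'a \<Rightarrow> real^'n" and w :: "'a \<Rightarrow> real"
  assumes int: "\<And>i j. integrable Q (\<lambda>x. w x * (y x $ i * y x $ j))"
  shows "integrable Q (\<lambda>x. w x * ((v \<bullet> y x) * (u \<bullet> y x)))"
    and "(\<integral>x. w x * ((v \<bullet> y x) * (u \<bullet> y x)) \<partial>Q) = v \<bullet> ((\<chi> i j. \<integral>x. w x * (y x $ i * y x $ j) \<partial>Q) *v u)"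
proof -
  have eq: "w x * ((v \<bullet> y x) * (u \<bullet> y x)) = (\<Sum>i\<in>UNIV. \<Sum>j\<in>UNIV. v$i * u$j * (w x * (y x $ i * y x $ j)))" for x
    by (simp add: inner_vec_def sum_product sum_distrib_left algebra_simps)
  show "integrable Q (\<lambda>x. w x * ((v \<bullet> y x) * (u \<bullet> y x)))"
    unfolding eq by (intro Bochner_Integration.integrable_sum integrable_mult_right int)
  have "(\<integral>x. w x * ((v \<bullet> y x) * (u \<bullet> y x)) \<partial>Q)
      = (\<Sum>i\<in>UNIV. \<Sum>j\<in>UNIV. v$i * u$j * (\<integral>x. w x * (y x $ i * y x $ j) \<partial>Q))"
    unfolding eq by (simp add: int Bochner_Integration.integral_sum)
  also have "\<dots> = v \<bullet> ((\<chi> i j. \<integral>x. w x * (y x $ i * y x $ j) \<partial>Q) *v u)"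
    by (simp add: inner_vec_def matrix_vector_mult_def sum_distrib_left algebra_simps)
  finally show "(\<integral>x. w x * ((v \<bullet> y x) * (u \<bullet> y x)) \<partial>Q)
      = v \<bullet> ((\<chi> i j. \<integral>x. w x * (y x $ i * y x $ j) \<partial>Q) *v u)" .
qed

lemma second_moment_form:
  fixes \<nu> :: "(real^'n) measure"
  assumes int: "\<And>i j. integrable \<nu> (\<lambda>\<theta>. \<theta> $ i * \<theta> $ j)"
  shows "integrable \<nu> (\<lambda>\<theta>. (v \<bullet> \<theta>)^2)"
    and "(\<integral>\<theta>. (v \<bullet> \<theta>)^2 \<partial>\<nu>) = v \<bullet> (second_moment \<nu> *v v)"
  using moment_form[of \<nu> "\<lambda>_. 1" "\<lambda>\<theta>. \<theta>" v v] int
  by (simp_all add: second_moment_def power2_eq_square)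

lemma second_moment_psd:
  fixes \<nu> :: "(real^'n) measure"
  assumes int: "\<And>i j. integrable \<nu> (\<lambda>\<theta>. \<theta> $ i * \<theta> $ j)"
  shows "psd (second_moment \<nu>)"
proof -
  have "transpose (second_moment \<nu>) = second_moment \<nu>"
    by (simp add: second_moment_def transpose_def vec_eq_iff mult.commute)
  moreover have "0 \<le> v \<bullet> (second_moment \<nu> *v v)" for v
    unfolding second_moment_form(2)[OF int, symmetric] by simp
  ultimately show ?thesis by (simp add: psd_def)
qed

text \<open>This turns the average of \<open>(w \<bullet> \<theta>)^2\<close> over the parameter,
  which is a quadratic form in its second moment, into a squared norm in the transformed
  covariates.\<close>

lemma norm_msqrt:
  fixes H :: "real^'n^'n"
  assumes "psd H"
  shows "(norm (msqrt H *v w))^2 = w \<bullet> (H *v w)"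
proof -
  note p = msqrt_psd[OF assms]
  have "w \<bullet> (H *v w) = w \<bullet> (msqrt H *v (msqrt H *v w))" by (simp add: matrix_vector_mul_assoc p)
  also have "\<dots> = (msqrt H *v w) \<bullet> (msqrt H *v w)" using p(1) by (intro symmetric_inner) (simp add: psd_def)
  finally show ?thesis by (simp add: dot_square_norm)
qed

text \<open>Independence makes the off-diagonal products factor. The factor laws may differ, since
  the noise law depends on the covariate; the lemma is used for weighted noise sums and for the
  training energy of the extremal design.\<close>

lemma product_sum_moments:
  fixes f :: "'i \<Rightarrow> 'a \<Rightarrow> real"
  assumes fin: "finite I" and M: "\<And>i. prob_space (M i)"
    and f: "\<And>i. i \<in> I \<Longrightarrow> integrable (M i) (f i)"
    and f2: "\<And>i. i \<in> I \<Longrightarrow> integrable (M i) (\<lambda>x. (f i x)^2)"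
  shows "integrable (PiM I M) (\<lambda>x. \<Sum>i\<in>I. f i (x i))"
    and "integrable (PiM I M) (\<lambda>x. (\<Sum>i\<in>I. f i (x i))^2)"
    and "(\<integral>x. (\<Sum>i\<in>I. f i (x i)) \<partial>PiM I M) = (\<Sum>i\<in>I. integral\<^sup>L (M i) (f i))"
    and "(\<integral>x. (\<Sum>i\<in>I. f i (x i))^2 \<partial>PiM I M)
       = (\<Sum>i\<in>I. (\<integral>x. (f i x)^2 \<partial>M i)) + (\<Sum>i\<in>I. integral\<^sup>L (M i) (f i))^2 - (\<Sum>i\<in>I. (integral\<^sup>L (M i) (f i))^2)"
proof -
  interpret M: prob_space "M i" for i by (rule M)
  interpret product_sigma_finite M by standard
  have one: "integrable (PiM I M) (\<lambda>x. g (x i)) \<and> (\<integral>x. g (x i) \<partial>PiM I M) = integral\<^sup>L (M i) g"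
    if i: "i \<in> I" and g: "integrable (M i) g" for i and g :: "'a \<Rightarrow> real"
  proof -
    have d: "distr (PiM I M) (M i) (\<lambda>x. x i) = M i" using M i by (intro distr_PiM_component)
    show ?thesis
      using integrable_distr[of "\<lambda>x. x i" "PiM I M" "M i" g] integral_distr[of "\<lambda>x. x i" "PiM I M" "M i" g] i g
      by (simp add: d)
  qed
  have cross: "integrable (PiM I M) (\<lambda>x. f i (x i) * f j (x j)) \<and>
      (\<integral>x. f i (x i) * f j (x j) \<partial>PiM I M)
       = integral\<^sup>L (M i) (f i) * integral\<^sup>L (M j) (f j)
          + (if i = j then (\<integral>x. (f i x)^2 \<partial>M i) - (integral\<^sup>L (M i) (f i))^2 else 0)"
    if i: "i \<in> I" and j: "j \<in> I" for i j
  proof (cases "i = j")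
    case True
    thus ?thesis using one[OF i f2[OF i]] by (simp add: power2_eq_square)
  next
    case False
    \<comment> \<open>Padding with the constant 1 writes a product of two coordinates as a product
      over all of \<open>I\<close>, to which the product integral formula applies.\<close>
    define h where "h k = (if k \<in> {i, j} then f k else (\<lambda>_. 1))" for k
    have h: "integrable (M k) (h k)" if "k \<in> I" for k using that f by (simp add: h_def)
    have sub: "{i, j} \<subseteq> I" using i j by simp
    have "(\<Prod>k\<in>I. h k (x k)) = (\<Prod>k\<in>{i, j}. h k (x k))" for x
      by (rule prod.mono_neutral_right[OF fin sub]) (auto simp: h_def)
    hence 1: "(\<Prod>k\<in>I. h k (x k)) = f i (x i) * f j (x j)" for x using False by (simp add: h_def)
    have "(\<Prod>k\<in>I. integral\<^sup>L (M k) (h k)) = (\<Prod>k\<in>{i, j}. integral\<^sup>L (M k) (h k))"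
      by (rule prod.mono_neutral_right[OF fin sub]) (auto simp: h_def M.prob_space)
    hence 2: "(\<Prod>k\<in>I. integral\<^sup>L (M k) (h k)) = integral\<^sup>L (M i) (f i) * integral\<^sup>L (M j) (f j)"
      using False by (simp add: h_def)
    show ?thesis
      using product_integrable_prod[OF fin h] product_integral_prod[OF fin h] False
      by (simp add: 1 2)
  qed
  have sq: "(\<Sum>i\<in>I. f i (x i))^2 = (\<Sum>i\<in>I. \<Sum>j\<in>I. f i (x i) * f j (x j))" for x
    by (simp add: power2_eq_square sum_product)
  show "integrable (PiM I M) (\<lambda>x. \<Sum>i\<in>I. f i (x i))" using one f by (intro Bochner_Integration.integrable_sum) auto
  show "integrable (PiM I M) (\<lambda>x. (\<Sum>i\<in>I. f i (x i))^2)"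
    unfolding sq using cross by (intro Bochner_Integration.integrable_sum) auto
  show "(\<integral>x. (\<Sum>i\<in>I. f i (x i)) \<partial>PiM I M) = (\<Sum>i\<in>I. integral\<^sup>L (M i) (f i))"
    using one f by (subst Bochner_Integration.integral_sum) auto
  have "(\<integral>x. (\<Sum>i\<in>I. f i (x i))^2 \<partial>PiM I M) = (\<Sum>i\<in>I. \<Sum>j\<in>I. \<integral>x. f i (x i) * f j (x j) \<partial>PiM I M)"
    unfolding sq using cross by (subst Bochner_Integration.integral_sum; auto intro!: sum.cong Bochner_Integration.integrable_sum Bochner_Integration.integral_sum)
  also have "\<dots> = (\<Sum>i\<in>I. \<Sum>j\<in>I. integral\<^sup>L (M i) (f i) * integral\<^sup>L (M j) (f j)
          + (if i = j then (\<integral>x. (f i x)^2 \<partial>M i) - (integral\<^sup>L (M i) (f i))^2 else 0))"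
    using cross by (intro sum.cong) auto
  also have "\<dots> = (\<Sum>i\<in>I. integral\<^sup>L (M i) (f i))^2 + (\<Sum>i\<in>I. (\<integral>x. (f i x)^2 \<partial>M i) - (integral\<^sup>L (M i) (f i))^2)"
    by (simp add: sum.distrib power2_eq_square sum_product fin)
  finally show "(\<integral>x. (\<Sum>i\<in>I. f i (x i))^2 \<partial>PiM I M)
       = (\<Sum>i\<in>I. (\<integral>x. (f i x)^2 \<partial>M i)) + (\<Sum>i\<in>I. integral\<^sup>L (M i) (f i))^2 - (\<Sum>i\<in>I. (integral\<^sup>L (M i) (f i))^2)"
    by (simp add: sum_subtractf)
qed

text \<open>The mixed term drops out because \<open>f\<close> has mean zero. Used with
  \<open>f\<close> the test noise and with \<open>f\<close> the weighted sum of training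
  noises.\<close>

lemma centered_second_moment:
  assumes "prob_space Q" "integrable Q (\<lambda>x. f x)" "integrable Q (\<lambda>x. (f x)^2)" "(\<integral>x. f x \<partial>Q) = (0::real)" and "c \<ge> 0"
  shows "(\<integral>\<^sup>+x. ennreal ((a + f x)^2 + c) \<partial>Q) = ennreal (a^2 + (\<integral>x. (f x)^2 \<partial>Q) + c)"
proof -
  interpret prob_space Q by fact
  have eq: "(a + f x)^2 + c = a^2 + 2 * a * f x + (f x)^2 + c" for x by (simp add: power2_sum)
  have int: "integrable Q (\<lambda>x. (a + f x)^2 + c)" unfolding eq using assms by simp
  have "(\<integral>\<^sup>+x. ennreal ((a + f x)^2 + c) \<partial>Q) = ennreal (\<integral>x. (a + f x)^2 + c \<partial>Q)"
    using \<open>c \<ge> 0\<close> by (intro nn_integral_eq_integral int) auto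
  also have "(\<integral>x. (a + f x)^2 + c \<partial>Q) = a^2 + (\<integral>x. (f x)^2 \<partial>Q) + c"
    unfolding eq using assms by (simp add: prob_space)
  finally show ?thesis .
qed

text \<open>Stated for arbitrary measurable arguments, so that it covers every ordering of the
  product spaces below and also arguments held constant.\<close>

lemma linear_rule_measurable:
  assumes "linear_rule n mu l" "i < n"
    and [measurable]: "x \<in> borel_measurable M" "X \<in> measurable M (PiM {..<n} (\<lambda>_. borel))" "u \<in> borel_measurable M"
  shows "(\<lambda>p. l i (x p) (X p) (u p)) \<in> borel_measurable M"
proof -
  have mu[measurable_cong]: "sets mu = sets borel" and
   L: "(\<lambda>(x, Xs, u). l i x Xs u) \<in> borel_measurable (borel \<Otimes>\<^sub>M (PiM {..<n} (\<lambda>_. borel) \<Otimes>\<^sub>M mu))"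
    using assms by (auto simp: linear_rule_def)
  have "(\<lambda>p. (x p, X p, u p)) \<in> measurable M (borel \<Otimes>\<^sub>M (PiM {..<n} (\<lambda>_. borel) \<Otimes>\<^sub>M mu))"
    by measurable
  from measurable_compose[OF this L] show ?thesis by simp
qed

lemma noise_average:
  fixes n :: nat
  assumes N: "noise_kernel N s"
  shows "(\<integral>\<^sup>+e. ennreal ((a + e)^2) \<partial>N x) = ennreal (a^2 + s)"
    and "(\<integral>\<^sup>+es. ennreal ((a + (\<Sum>i<n. b i * es i))^2 + s) \<partial>PiM {..<n} (\<lambda>i. N (X i)))
        = ennreal (a^2 + s * (\<Sum>i<n. (b i)^2) + s)"
    and "s \<ge> 0"
proof -
  have N': "prob_space (N x)" "integrable (N x) (\<lambda>e. e)" "integrable (N x) (\<lambda>e. e^2)"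
     "(\<integral>e. e \<partial>N x) = 0" "(\<integral>e. e^2 \<partial>N x) = s" for x
    using N by (auto simp: noise_kernel_def)
  have "0 \<le> (\<integral>e. e^2 \<partial>N x)" by simp
  thus s: "s \<ge> 0" using N' by simp
  show "(\<integral>\<^sup>+e. ennreal ((a + e)^2) \<partial>N x) = ennreal (a^2 + s)"
    using centered_second_moment[of "N x" "\<lambda>e. e" 0 a] N' by simp
  let ?Q = "PiM {..<n} (\<lambda>i. N (X i))"
  note m = product_sum_moments[of "{..<n}" "\<lambda>i. N (X i)" "\<lambda>i e. b i * e", OF finite_lessThan]
  have "prob_space ?Q" using N' by (intro prob_space_PiM) auto
  moreover have "integrable ?Q (\<lambda>es. \<Sum>i<n. b i * es i)" "integrable ?Q (\<lambda>es. (\<Sum>i<n. b i * es i)^2)"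
    "(\<integral>es. (\<Sum>i<n. b i * es i) \<partial>?Q) = 0" "(\<integral>es. (\<Sum>i<n. b i * es i)^2 \<partial>?Q) = s * (\<Sum>i<n. (b i)^2)"
    using m N' by (auto simp: power_mult_distrib sum_distrib_left mult.commute)
  ultimately show "(\<integral>\<^sup>+es. ennreal ((a + (\<Sum>i<n. b i * es i))^2 + s) \<partial>?Q)
        = ennreal (a^2 + s * (\<Sum>i<n. (b i)^2) + s)"
    using centered_second_moment[of ?Q "\<lambda>es. \<Sum>i<n. b i * es i" s a] s by simp
qed

text \<open>Bias-variance decomposition. The test noise is averaged first and contributes
  \<open>s\<close>; two applications of Tonelli then bring the training noise innermost, where it
  contributes \<open>s\<close> times the sum of squared weights.\<close>

lemma expected_risk_eq:
  fixes P :: "(real^'n) measure"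
  assumes P: "prob_space P" "sets P = sets borel" and N: "noise_kernel N s" and l: "linear_rule n mu l"
  shows "expected_risk n P N mu l \<theta> =
    (\<integral>\<^sup>+X. \<integral>\<^sup>+u. \<integral>\<^sup>+x. ennreal (((x - (\<Sum>i<n. l i x X u *\<^sub>R X i)) \<bullet> \<theta>)^2 + s * (\<Sum>i<n. (l i x X u)^2) + s)
       \<partial>P \<partial>mu \<partial>PiM {..<n} (\<lambda>_. P))"
proof -
  interpret P: prob_space P by fact
  interpret mu: prob_space mu using l by (simp add: linear_rule_def)
  have [measurable_cong]: "sets P = sets borel" "sets mu = sets borel"
    using P l by (auto simp: linear_rule_def)
  have spN: "sets (N x) = sets borel" "prob_space (N x)" for x using N by (auto simp: noise_kernel_def)
  show ?thesis unfolding expected_risk_def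
  proof (rule nn_integral_cong)
    fix X assume X: "X \<in> space (PiM {..<n} (\<lambda>_. P))"
    hence X': "X \<in> space (PiM {..<n} (\<lambda>_. borel :: (real^'n) measure))"
      using sets_eq_imp_space_eq[OF P(2)] by (simp add: space_PiM)
    \<comment> \<open>The noise law depends on the covariates, so the swaps are made for fixed
      \<open>X\<close>; its sigma-algebra does not depend on \<open>X\<close>.\<close>
    let ?Q = "PiM {..<n} (\<lambda>i. N (X i))"
    have setsQ[measurable_cong]: "sets ?Q = sets (PiM {..<n} (\<lambda>_. borel))"
      by (intro sets_PiM_cong refl spN)
    interpret Q: prob_space ?Q by (intro prob_space_PiM spN)
    interpret p1: pair_sigma_finite mu ?Q ..
    interpret p2: pair_sigma_finite P ?Q ..
    define F where "F es u x = ennreal ((x \<bullet> \<theta> - (\<Sum>i<n. l i x X u * (X i \<bullet> \<theta> + es i)))^2 + s)" for es u x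
    have F: "(\<lambda>p. F (es p) (u p) (x p)) \<in> borel_measurable M"
      if [measurable]: "x \<in> borel_measurable M" "u \<in> borel_measurable M" "es \<in> measurable M (PiM {..<n} (\<lambda>_. borel))"
      for x u es and M :: "'z measure"
    proof -
      have [measurable]: "(\<lambda>p. l i (x p) X (u p)) \<in> borel_measurable M" if "i \<in> {..<n}" for i
        using that X' by (intro linear_rule_measurable[OF l]) auto
      have [measurable]: "(\<lambda>p. es p i) \<in> borel_measurable M" if "i \<in> {..<n}" for i
        using that by measurable
      show ?thesis unfolding F_def by measurable
    qed
    have inner: "(\<integral>\<^sup>+e. ennreal ((x \<bullet> \<theta> + e - (\<Sum>i<n. l i x X u * (X i \<bullet> \<theta> + es i)))^2) \<partial>N x) = F es u x" for es u x
      using noise_average(1)[OF N, where x = x and a = "x \<bullet> \<theta> - (\<Sum>i<n. l i x X u * (X i \<bullet> \<theta> + es i))"]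
      by (simp add: F_def algebra_simps)
    have noise: "(\<integral>\<^sup>+es. F es u x \<partial>?Q)
       = ennreal (((x - (\<Sum>i<n. l i x X u *\<^sub>R X i)) \<bullet> \<theta>)^2 + s * (\<Sum>i<n. (l i x X u)^2) + s)" for u x
    proof -
      have "x \<bullet> \<theta> - (\<Sum>i<n. l i x X u * (X i \<bullet> \<theta> + es i))
         = (x - (\<Sum>i<n. l i x X u *\<^sub>R X i)) \<bullet> \<theta> + (\<Sum>i<n. (- l i x X u) * es i)" for es
        by (simp add: inner_diff_left inner_sum_left algebra_simps sum.distrib sum_negf)
      thus ?thesis unfolding F_def using noise_average(2)[OF N, where n = n and b = "\<lambda>i. - l i x X u"] by simp
    qed
    have "(\<integral>\<^sup>+es. \<integral>\<^sup>+u. \<integral>\<^sup>+x. F es u x \<partial>P \<partial>mu \<partial>?Q) = (\<integral>\<^sup>+u. \<integral>\<^sup>+es. \<integral>\<^sup>+x. F es u x \<partial>P \<partial>?Q \<partial>mu)"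
    proof (rule p1.Fubini')
      have "(\<lambda>p. F (snd (fst p)) (fst (fst p)) (snd p)) \<in> borel_measurable ((mu \<Otimes>\<^sub>M ?Q) \<Otimes>\<^sub>M P)"
        by (rule F) measurable
      hence "(\<lambda>q. \<integral>\<^sup>+x. F (snd q) (fst q) x \<partial>P) \<in> borel_measurable (mu \<Otimes>\<^sub>M ?Q)"
        by (intro P.borel_measurable_nn_integral) (simp add: case_prod_beta')
      thus "(\<lambda>(u, es). \<integral>\<^sup>+x. F es u x \<partial>P) \<in> borel_measurable (mu \<Otimes>\<^sub>M ?Q)" by (simp add: case_prod_beta')
    qed
    also have "\<dots> = (\<integral>\<^sup>+u. \<integral>\<^sup>+x. \<integral>\<^sup>+es. F es u x \<partial>?Q \<partial>P \<partial>mu)"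
    proof (intro nn_integral_cong p2.Fubini')
      fix u :: real
      have "(\<lambda>p. F (snd p) u (fst p)) \<in> borel_measurable (P \<Otimes>\<^sub>M ?Q)"
        by (rule F) measurable
      thus "(\<lambda>(x, es). F es u x) \<in> borel_measurable (P \<Otimes>\<^sub>M ?Q)" by (simp add: case_prod_beta')
    qed
    finally show "(\<integral>\<^sup>+es. \<integral>\<^sup>+u. \<integral>\<^sup>+x. \<integral>\<^sup>+e. ennreal ((x \<bullet> \<theta> + e - (\<Sum>i<n. l i x X u * (X i \<bullet> \<theta> + es i)))^2)
      \<partial>N x \<partial>P \<partial>mu \<partial>?Q) = (\<integral>\<^sup>+u. \<integral>\<^sup>+x.
       ennreal (((x - (\<Sum>i<n. l i x X u *\<^sub>R X i)) \<bullet> \<theta>)^2 + s * (\<Sum>i<n. (l i x X u)^2) + s) \<partial>P \<partial>mu)"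
      unfolding inner noise .
  qed
qed

text \<open>Three applications of Tonelli move the parameter inside the integrals over
  \<open>X\<close>, \<open>u\<close> and \<open>x\<close>. There only the second moment of
  \<open>\<nu>\<close> matters, and its square root acts on the covariates.\<close>

lemma average_risk_eq:
  fixes P \<nu> :: "(real^'n) measure"
  assumes P: "prob_space P" "sets P = sets borel" and N: "noise_kernel N s" and l: "linear_rule n mu l"
    and \<nu>: "prob_space \<nu>" "sets \<nu> = sets borel" "\<And>i j. integrable \<nu> (\<lambda>\<theta>. \<theta> $ i * \<theta> $ j)"
  defines "R \<equiv> msqrt (second_moment \<nu>)"
  shows "(\<integral>\<^sup>+\<theta>. expected_risk n P N mu l \<theta> \<partial>\<nu>) =
    (\<integral>\<^sup>+X. \<integral>\<^sup>+u. \<integral>\<^sup>+x. ennreal ((norm (R *v x - (\<Sum>i<n. l i x X u *\<^sub>R (R *v X i))))^2 + s * (\<Sum>i<n. (l i x X u)^2) + s)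
       \<partial>P \<partial>mu \<partial>PiM {..<n} (\<lambda>_. P))"
proof -
  interpret P: prob_space P by fact
  interpret \<nu>: prob_space \<nu> by fact
  interpret mu: prob_space mu using l by (simp add: linear_rule_def)
  have [measurable_cong]: "sets P = sets borel" "sets mu = sets borel" "sets \<nu> = sets borel"
    using P l \<nu> by (auto simp: linear_rule_def)
  let ?T = "PiM {..<n} (\<lambda>_. P)"
  have [measurable_cong]: "sets ?T = sets (PiM {..<n} (\<lambda>_. borel))"
    by (intro sets_PiM_cong refl P)
  interpret T: prob_space ?T by (intro prob_space_PiM P)
  interpret p1: pair_sigma_finite ?T \<nu> ..
  interpret p2: pair_sigma_finite mu \<nu> ..
  interpret p3: pair_sigma_finite P \<nu> ..
  define F where "F \<theta> X u x = ennreal (((x - (\<Sum>i<n. l i x X u *\<^sub>R X i)) \<bullet> \<theta>)^2 + s * (\<Sum>i<n. (l i x X u)^2) + s)"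
    for \<theta> X u x
  have F: "(\<lambda>p. F (\<theta> p) (X p) (u p) (x p)) \<in> borel_measurable M"
    if [measurable]: "x \<in> borel_measurable M" "u \<in> borel_measurable M" "X \<in> measurable M (PiM {..<n} (\<lambda>_. borel))"
      "\<theta> \<in> borel_measurable M"
    for x u X \<theta> and M :: "'z measure"
  proof -
    have [measurable]: "(\<lambda>p. l i (x p) (X p) (u p)) \<in> borel_measurable M" if "i \<in> {..<n}" for i
      using that by (intro linear_rule_measurable[OF l]) auto
    have [measurable]: "(\<lambda>p. X p i) \<in> borel_measurable M" if "i \<in> {..<n}" for i
      using that by measurable
    show ?thesis unfolding F_def by measurable
  qed
  have avg: "(\<integral>\<^sup>+\<theta>. F \<theta> X u x \<partial>\<nu>) = ennreal ((norm (R *v x - (\<Sum>i<n. l i x X u *\<^sub>R (R *v X i))))^2 + s * (\<Sum>i<n. (l i x X u)^2) + s)"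
    for X u x
  proof -
    define w where "w = x - (\<Sum>i<n. l i x X u *\<^sub>R X i)"
    define c where "c = s * (\<Sum>i<n. (l i x X u)^2) + s"
    have c: "c \<ge> 0" using noise_average(3)[OF N] by (simp add: c_def sum_nonneg)
    have "(\<integral>\<^sup>+\<theta>. F \<theta> X u x \<partial>\<nu>) = (\<integral>\<^sup>+\<theta>. ennreal ((w \<bullet> \<theta>)^2 + c) \<partial>\<nu>)" by (simp add: F_def w_def c_def add.assoc)
    also have "\<dots> = ennreal (\<integral>\<theta>. (w \<bullet> \<theta>)^2 + c \<partial>\<nu>)"
      using c by (intro nn_integral_eq_integral) (auto intro!: second_moment_form \<nu>)
    also have "(\<integral>\<theta>. (w \<bullet> \<theta>)^2 + c \<partial>\<nu>) = (norm (R *v w))^2 + c"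
      using second_moment_form[OF \<nu>(3), of w] norm_msqrt[OF second_moment_psd[OF \<nu>(3)], of w]
      by (simp add: \<nu>.prob_space R_def)
    also have "R *v w = R *v x - (\<Sum>i<n. l i x X u *\<^sub>R (R *v X i))"
      by (simp add: w_def matrix_vector_mult_diff_distrib linear_sum[OF matrix_vector_mul_linear] matrix_vector_mult_scaleR)
    finally show ?thesis by (simp add: c_def add.assoc)
  qed
  have "(\<integral>\<^sup>+\<theta>. expected_risk n P N mu l \<theta> \<partial>\<nu>) = (\<integral>\<^sup>+\<theta>. \<integral>\<^sup>+X. \<integral>\<^sup>+u. \<integral>\<^sup>+x. F \<theta> X u x \<partial>P \<partial>mu \<partial>?T \<partial>\<nu>)"
    unfolding F_def by (intro nn_integral_cong expected_risk_eq P N l)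
  also have "\<dots> = (\<integral>\<^sup>+X. \<integral>\<^sup>+\<theta>. \<integral>\<^sup>+u. \<integral>\<^sup>+x. F \<theta> X u x \<partial>P \<partial>mu \<partial>\<nu> \<partial>?T)"
  proof (rule p1.Fubini')
    have "(\<lambda>p. F (snd (fst (fst p))) (fst (fst (fst p))) (snd (fst p)) (snd p)) \<in> borel_measurable (((?T \<Otimes>\<^sub>M \<nu>) \<Otimes>\<^sub>M mu) \<Otimes>\<^sub>M P)"
      by (rule F) measurable
    hence "(\<lambda>q. \<integral>\<^sup>+x. F (snd (fst q)) (fst (fst q)) (snd q) x \<partial>P) \<in> borel_measurable ((?T \<Otimes>\<^sub>M \<nu>) \<Otimes>\<^sub>M mu)"
      by (intro P.borel_measurable_nn_integral) (simp add: case_prod_beta')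
    hence "(\<lambda>q. \<integral>\<^sup>+u. \<integral>\<^sup>+x. F (snd q) (fst q) u x \<partial>P \<partial>mu) \<in> borel_measurable (?T \<Otimes>\<^sub>M \<nu>)"
      by (intro mu.borel_measurable_nn_integral) (simp add: case_prod_beta')
    thus "(\<lambda>(X, \<theta>). \<integral>\<^sup>+u. \<integral>\<^sup>+x. F \<theta> X u x \<partial>P \<partial>mu) \<in> borel_measurable (?T \<Otimes>\<^sub>M \<nu>)"
      by (simp add: case_prod_beta')
  qed
  also have "\<dots> = (\<integral>\<^sup>+X. \<integral>\<^sup>+u. \<integral>\<^sup>+\<theta>. \<integral>\<^sup>+x. F \<theta> X u x \<partial>P \<partial>\<nu> \<partial>mu \<partial>?T)"
  proof (intro nn_integral_cong p2.Fubini')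
    fix X assume "X \<in> space ?T"
    hence X: "X \<in> space (PiM {..<n} (\<lambda>_. borel :: (real^'n) measure))"
      using sets_eq_imp_space_eq[OF P(2)] by (simp add: space_PiM)
    hence "(\<lambda>p. F (snd (fst p)) X (fst (fst p)) (snd p)) \<in> borel_measurable ((mu \<Otimes>\<^sub>M \<nu>) \<Otimes>\<^sub>M P)"
      by (intro F measurable_const X) measurable
    hence "(\<lambda>q. \<integral>\<^sup>+x. F (snd q) X (fst q) x \<partial>P) \<in> borel_measurable (mu \<Otimes>\<^sub>M \<nu>)"
      by (intro P.borel_measurable_nn_integral) (simp add: case_prod_beta')
    thus "(\<lambda>(u, \<theta>). \<integral>\<^sup>+x. F \<theta> X u x \<partial>P) \<in> borel_measurable (mu \<Otimes>\<^sub>M \<nu>)"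
      by (simp add: case_prod_beta')
  qed
  also have "\<dots> = (\<integral>\<^sup>+X. \<integral>\<^sup>+u. \<integral>\<^sup>+x. \<integral>\<^sup>+\<theta>. F \<theta> X u x \<partial>\<nu> \<partial>P \<partial>mu \<partial>?T)"
  proof (intro nn_integral_cong p3.Fubini')
    fix X and u :: real assume "X \<in> space ?T"
    hence X: "X \<in> space (PiM {..<n} (\<lambda>_. borel :: (real^'n) measure))"
      using sets_eq_imp_space_eq[OF P(2)] by (simp add: space_PiM)
    hence "(\<lambda>p. F (snd p) X u (fst p)) \<in> borel_measurable (P \<Otimes>\<^sub>M \<nu>)"
      by (intro F measurable_const X) measurable
    thus "(\<lambda>(x, \<theta>). F \<theta> X u x) \<in> borel_measurable (P \<Otimes>\<^sub>M \<nu>)"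
      by (simp add: case_prod_beta')
  qed
  finally show ?thesis unfolding avg .
qed

subsection \<open>Atomic covariate laws\<close>

text \<open>The index \<open>None\<close> carries the missing mass \<open>1 - sum p B\<close> and is
  sent to the origin. Building the law on indices and pushing it forward leaves the atoms
  \<open>g b\<close> free to coincide.\<close>

definition atomic_law :: "'a set \<Rightarrow> ('a \<Rightarrow> real) \<Rightarrow> ('a \<Rightarrow> real^'n) \<Rightarrow> (real^'n) measure" where
  "atomic_law B p g = distr (measure_pmf (embed_pmf (\<lambda>a. case a of None \<Rightarrow> 1 - sum p B | Some b \<Rightarrow> if b \<in> B then p b else 0)))
     borel (case_option 0 g)"

lemma atomic_law:
  fixes g :: "'a \<Rightarrow> real^'n"
  assumes B: "finite B" and p: "\<And>b. b \<in> B \<Longrightarrow> p b \<ge> 0" "sum p B \<le> 1"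
  shows "prob_space (atomic_law B p g)" "sets (atomic_law B p g) = sets borel"
    and "f \<in> borel_measurable borel \<Longrightarrow>
      (\<integral>\<^sup>+x. f x \<partial>atomic_law B p g) = (\<Sum>b\<in>B. ennreal (p b) * f (g b)) + ennreal (1 - sum p B) * f 0"
    and "h \<in> borel_measurable borel \<Longrightarrow> integrable (atomic_law B p g) (h :: _ \<Rightarrow> real)"
    and "h \<in> borel_measurable borel \<Longrightarrow>
      (\<integral>x. h x \<partial>atomic_law B p g) = (\<Sum>b\<in>B. p b * h (g b)) + (1 - sum p B) * h 0"
    and "(\<And>b. b \<in> B \<Longrightarrow> Q (g b)) \<Longrightarrow> Q 0 \<Longrightarrow> {x. Q x} \<in> sets borel \<Longrightarrow> AE x in atomic_law B p g. Q x"
proof -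
  define w where "w = (\<lambda>a. case a of None \<Rightarrow> 1 - sum p B | Some b \<Rightarrow> if b \<in> B then p b else 0)"
  define S where "S = insert None (Some ` B)"
  have fS: "finite S" using B by (simp add: S_def)
  have w0: "w a \<ge> 0" for a using p by (auto simp: w_def split: option.split)
  have sumS: "(\<Sum>a\<in>S. k a) = k None + (\<Sum>b\<in>B. k (Some b))" for k :: "'a option \<Rightarrow> 'b::comm_monoid_add"
    unfolding S_def using B by (subst sum.insert) (auto simp: sum.reindex)
  have "(\<integral>\<^sup>+a. ennreal (w a) \<partial>count_space UNIV) = (\<Sum>a\<in>S. ennreal (w a))"
    using fS by (intro nn_integral_count_space') (auto simp: S_def w_def split: option.split if_splits)
  also have "\<dots> = ennreal (\<Sum>a\<in>S. w a)" using w0 by (intro sum_ennreal) auto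
  also have "(\<Sum>a\<in>S. w a) = 1" by (simp add: sumS w_def)
  finally have w1: "(\<integral>\<^sup>+a. ennreal (w a) \<partial>count_space UNIV) = 1" by simp
  define q where "q = embed_pmf w"
  have q: "pmf q a = w a" for a unfolding q_def by (rule pmf_embed_pmf[OF w0 w1])
  have set_q: "set_pmf q \<subseteq> S" by (auto simp: set_pmf_iff q w_def S_def split: option.splits if_splits)
  have P: "atomic_law B p g = distr (measure_pmf q) borel (case_option 0 g)"
    by (simp add: atomic_law_def q_def w_def)
  show "prob_space (atomic_law B p g)" unfolding P by (intro measure_pmf.prob_space_distr) simp
  show "sets (atomic_law B p g) = sets borel" unfolding P by simp
  have *: "w (Some b) = (if b \<in> B then p b else 0)" "w None = 1 - sum p B" for b by (simp_all add: w_def)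
  show "(\<integral>\<^sup>+x. f x \<partial>atomic_law B p g) = (\<Sum>b\<in>B. ennreal (p b) * f (g b)) + ennreal (1 - sum p B) * f 0"
    if "f \<in> borel_measurable borel" for f
  proof -
    have "(\<integral>\<^sup>+x. f x \<partial>atomic_law B p g) = (\<integral>\<^sup>+a. f (case_option 0 g a) \<partial>measure_pmf q)"
      unfolding P using that by (subst nn_integral_distr) auto
    also have "\<dots> = (\<Sum>a\<in>S. f (case_option 0 g a) * ennreal (pmf q a))"
      using set_q fS by (intro nn_integral_measure_pmf_support) (auto simp: set_pmf_iff)
    finally show ?thesis by (simp add: sumS q * mult.commute add.commute)
  qed
  have fin: "finite (set_pmf q)" using set_q fS finite_subset by blast
  show "integrable (atomic_law B p g) h" if "h \<in> borel_measurable borel" for h :: "_ \<Rightarrow> real"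
    unfolding P using that fin by (subst integrable_distr_eq) (auto intro: integrable_measure_pmf_finite)
  show "(\<integral>x. h x \<partial>atomic_law B p g) = (\<Sum>b\<in>B. p b * h (g b)) + (1 - sum p B) * h 0"
    if "h \<in> borel_measurable borel" for h :: "_ \<Rightarrow> real"
  proof -
    have "(\<integral>x. h x \<partial>atomic_law B p g) = (\<integral>a. h (case_option 0 g a) \<partial>measure_pmf q)"
      unfolding P using that by (subst integral_distr) auto
    also have "\<dots> = (\<Sum>a\<in>S. pmf q a *\<^sub>R h (case_option 0 g a))"
      using set_q fS by (intro integral_measure_pmf) auto
    finally show ?thesis by (simp add: sumS q * add.commute)
  qed
  show "AE x in atomic_law B p g. Q x"
    if "\<And>b. b \<in> B \<Longrightarrow> Q (g b)" "Q 0" "{x. Q x} \<in> sets borel" for Q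
    unfolding P using that set_q
    by (subst AE_distr_iff) (auto simp: AE_measure_pmf_iff S_def split: option.split)
qed

subsection \<open>One-dimensional ridge regression\<close>

text \<open>The minimal one-dimensional ridge error, normalised to 1 in the absence of signal. The
  separate case matters for \<open>s = 0\<close>, where \<open>s / (s + T)\<close> at
  \<open>T = 0\<close> would be 0 in HOL; thus \<open>shrinkage 0\<close> is the indicator of
  \<open>T = 0\<close>.\<close>

definition shrinkage :: "real \<Rightarrow> real \<Rightarrow> real" where
  "shrinkage s T = (if T = 0 then 1 else s / (s + T))"

lemma shrinkage_bounds:
  assumes "s \<ge> 0" "T \<ge> 0"
  shows "0 \<le> shrinkage s T" "shrinkage s T \<le> 1"
  using assms by (auto simp: shrinkage_def divide_simps)

lemma shrinkage_measurable [measurable]: "shrinkage s \<in> borel_measurable borel"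
  unfolding shrinkage_def by measurable

text \<open>The left-hand side is the minimum over \<open>l\<close> of the right-hand side, attained by ridge regression.\<close>

lemma ridge_lower_bound:
  fixes l r :: "nat \<Rightarrow> real"
  assumes s: "s \<ge> 0"
  shows "L^2 * shrinkage s (\<Sum>i<n. (r i)^2) \<le> (L - (\<Sum>i<n. l i * r i))^2 + s * (\<Sum>i<n. (l i)^2)"
proof -
  define K A T where "K = (\<Sum>i<n. l i * r i)" and "A = (\<Sum>i<n. (l i)^2)" and "T = (\<Sum>i<n. (r i)^2)"
  \<comment> \<open>Cauchy-Schwarz reduces the minimisation over all weights to the single number
    \<open>K\<close>. For \<open>T = 0\<close> it forces \<open>K = 0\<close>.\<close>
  have CS: "K^2 \<le> A * T" unfolding K_def A_def T_def by (rule Cauchy_Schwarz_ineq_sum)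
  have A: "A \<ge> 0" and T: "T \<ge> 0" by (auto simp: A_def T_def sum_nonneg)
  show ?thesis unfolding K_def[symmetric] A_def[symmetric] T_def[symmetric]
  proof (cases "T = 0")
    case True
    thus "L^2 * shrinkage s T \<le> (L - K)^2 + s * A" using CS A s by (simp add: shrinkage_def)
  next
    case False
    hence T: "T > 0" using T by simp
    \<comment> \<open>Completing the square in \<open>K\<close>; equality holds for
      \<open>K = T * L / (s + T)\<close>, the ridge value.\<close>
    have "0 \<le> (T * L - (s + T) * K)^2 / T" using T by simp
    also have "\<dots> = (s + T) * ((L - K)^2 + s * (K^2 / T)) - s * L^2"
      using T by (simp add: field_simps power2_eq_square)
    finally have "s * L^2 \<le> (s + T) * ((L - K)^2 + s * (K^2 / T))" by simp
    also have "\<dots> \<le> (s + T) * ((L - K)^2 + s * A)"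
    proof -
      have "K^2 / T \<le> A" using CS T by (simp add: divide_simps)
      thus ?thesis using s T by (intro mult_left_mono add_left_mono) auto
    qed
    finally have "s * L^2 \<le> ((L - K)^2 + s * A) * (s + T)" by (simp add: mult.commute)
    hence "s * L^2 / (s + T) \<le> (L - K)^2 + s * A" using s T by (simp add: pos_divide_le_eq)
    thus "L^2 * shrinkage s T \<le> (L - K)^2 + s * A" using T by (simp add: shrinkage_def mult.commute)
  qed
qed

text \<open>The right-hand side is \<open>s T\<close> times the tangent at \<open>c\<close> of the convex function \<open>T \<mapsto> 1 / (T (s + T))\<close>;
  it is quadratic in \<open>T\<close>, so that only two moments of \<open>T\<close> are needed.\<close>

lemma shrinkage_tangent:
  fixes s T c :: real
  assumes s: "s \<ge> 0" and T: "T \<ge> 0" and c: "c > 0"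
  shows "s * (T / (c * (s + c)) - (s + 2 * c) / (c * (s + c))^2 * (T^2 - c * T))
    \<le> shrinkage s T - shrinkage 0 T"
proof (cases "T = 0")
  case True
  thus ?thesis by (simp add: shrinkage_def)
next
  case False
  hence T: "T > 0" using T by simp
  \<comment> \<open>\<open>q\<close> and \<open>q'\<close> are the value and the derivative at
    \<open>c\<close> of \<open>T * (s + T)\<close>, so the tangent at \<open>c\<close> of its
    reciprocal is \<open>(q - q' * d) / q^2\<close>.\<close>
  define q q' d where "q = c * (s + c)" and "q' = s + 2 * c" and "d = T - c"
  have q: "q > 0" using s c by (simp add: q_def)
  have qT: "T * (s + T) = q + q' * d + d^2" by (simp add: q_def q'_def d_def algebra_simps power2_eq_square)
  have "q' * d + q' * c = q' * T" by (simp add: d_def algebra_simps)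
  hence "q'^2 - q + q' * d = q' * T + (s + c)^2" 
    by (simp add: q_def q'_def d_def algebra_simps power2_eq_square)
  hence "q'^2 - q + q' * d \<ge> 0" using T s c by (simp add: q'_def)
  \<comment> \<open>The right-hand side equals \<open>q^2 - (q - q' * d) * (T * (s + T))\<close>,
    the gap in the tangent inequality after clearing denominators.\<close>
  hence "0 \<le> d^2 * (q'^2 - q + q' * d)" by simp
  hence "(q - q' * d) * (T * (s + T)) \<le> q^2"
    unfolding qT by (simp add: algebra_simps power2_eq_square)
  hence "(q - q' * d) / q^2 \<le> 1 / (T * (s + T))"
    using T s q by (simp add: divide_simps mult.commute)
  hence "s * T * ((q - q' * d) / q^2) \<le> s * T * (1 / (T * (s + T)))"
    using s T by (intro mult_left_mono) auto
  moreover have "s * T * ((q - q' * d) / q^2) = s * (T / q - q' / q^2 * (T^2 - c * T))"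
    using q by (simp add: d_def field_simps power2_eq_square)
  moreover have "s * T * (1 / (T * (s + T))) = shrinkage s T - shrinkage 0 T"
    using T by (simp add: shrinkage_def)
  ultimately show ?thesis by (simp add: q_def q'_def)
qed

subsection \<open>The extremal design\<close>

text \<open>\<open>B\<close> stands for the eigenvectors with positive eigenvalue
  \<open>v b\<close>, so it need not span. Covariates live before the transformation by the possibly
  singular \<open>R\<close>, hence the chosen preimages \<open>g b\<close>; the bound on
  \<open>sum v B\<close> leaves a nonnegative mass for the origin.\<close>

locale eigen_design =
  fixes B :: "(real^'n) set" and v :: "real^'n \<Rightarrow> real" and L :: real and R :: "real^'n^'n"
    and g :: "real^'n \<Rightarrow> real^'n" and n :: nat
  assumes fin: "finite B" and orth: "\<And>a b. a \<in> B \<Longrightarrow> b \<in> B \<Longrightarrow> a \<bullet> b = (if a = b then 1 else 0)"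
    and L: "L > 0" and v: "\<And>b. b \<in> B \<Longrightarrow> v b > 0" and sum_v: "sum v B \<le> L^2"
    and Rg: "\<And>b. b \<in> B \<Longrightarrow> R *v g b = L *\<^sub>R b"
begin

definition "P = atomic_law B (\<lambda>b. v b / L^2) g"

text \<open>The energy of the training sample in direction \<open>b\<close>: when all samples are
  atoms, \<open>L^2\<close> times the number of samples at \<open>g b\<close>.\<close>

definition T :: "real^'n \<Rightarrow> (nat \<Rightarrow> real^'n) \<Rightarrow> real" where
  "T b X = (\<Sum>i<n. (b \<bullet> (R *v X i))^2)"

lemma T_nonneg: "T b X \<ge> 0" by (simp add: T_def sum_nonneg)

lemma sum_p: "(\<Sum>b\<in>B. v b / L^2) \<le> 1"
  using sum_v L by (simp add: sum_divide_distrib[symmetric])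

lemmas law = atomic_law[OF fin, where p = "\<lambda>b. v b / L^2" and g = g, folded P_def]

lemma prob_P: "prob_space P" and sets_P [measurable_cong]: "sets P = sets borel"
  by (rule law; use sum_p v in \<open>simp add: less_imp_le\<close>)+

sublocale P: prob_space P by (rule prob_P)

lemma nn_integral_P: "f \<in> borel_measurable borel \<Longrightarrow>
   (\<integral>\<^sup>+x. f x \<partial>P) = (\<Sum>b\<in>B. ennreal (v b / L^2) * f (g b)) + ennreal (1 - (\<Sum>b\<in>B. v b / L^2)) * f 0"
  by (rule law) (use sum_p v in \<open>auto simp: less_imp_le\<close>)

lemma integral_P: "f \<in> borel_measurable borel \<Longrightarrow>
   (\<integral>x. f x \<partial>P) = (\<Sum>b\<in>B. v b / L^2 * f (g b)) + (1 - (\<Sum>b\<in>B. v b / L^2)) * f 0" for f :: "_ \<Rightarrow> real"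
  by (rule law) (use sum_p v in \<open>auto simp: less_imp_le\<close>)

lemma integrable_P: "f \<in> borel_measurable borel \<Longrightarrow> integrable P f" for f :: "_ \<Rightarrow> real"
  by (rule law) (use sum_p v in \<open>auto simp: less_imp_le\<close>)

lemma AE_P: "(\<And>b. b \<in> B \<Longrightarrow> Q (g b)) \<Longrightarrow> Q 0 \<Longrightarrow> {x. Q x} \<in> sets borel \<Longrightarrow> AE x in P. Q x"
  by (rule law) (use sum_p v in \<open>auto simp: less_imp_le\<close>)

lemma R_measurable [measurable]: "(\<lambda>x. R *v x) \<in> borel_measurable borel"
  by (intro borel_measurable_continuous_onI linear_continuous_on)
    (simp add: linear_conv_bounded_linear[symmetric])

text \<open>Only the atom \<open>g b\<close> contributes: the others are mapped by \<open>R\<close>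
  to vectors orthogonal to \<open>b\<close>, and the origin drops out because
  \<open>k > 0\<close>.\<close>

lemma moment_P:
  assumes b: "b \<in> B" and k: "k > 0"
  shows "(\<integral>x. (b \<bullet> (R *v x))^k \<partial>P) = v b * L^k / L^2"
proof -
  have "(\<integral>x. (b \<bullet> (R *v x))^k \<partial>P) = (\<Sum>a\<in>B. v a / L^2 * (b \<bullet> (R *v g a))^k)"
    using k by (subst integral_P) auto
  also have "\<dots> = (\<Sum>a\<in>B. if a = b then v b * L^k / L^2 else 0)"
    using k b by (intro sum.cong) (auto simp: Rg orth power_mult_distrib)
  also have "\<dots> = v b * L^k / L^2" using fin b by simp
  finally show ?thesis .
qed

section \<open>Moments of the training energy and the expected shrinkage\<close>

abbreviation "train \<equiv> PiM {..<n} (\<lambda>_. P)"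

lemma sets_train [measurable_cong]: "sets train = sets (PiM {..<n} (\<lambda>_. borel))"
  by (intro sets_PiM_cong refl sets_P)

lemma prob_train: "prob_space train"
  by (intro prob_space_PiM prob_P)

sublocale train: prob_space train by (rule prob_train)

lemma T_measurable [measurable]: "T b \<in> borel_measurable train"
proof -
  have [measurable]: "(\<lambda>X. X i) \<in> borel_measurable train" if "i \<in> {..<n}" for i
    using that by measurable
  show ?thesis unfolding T_def by measurable
qed

lemma T_moments:
  assumes b: "b \<in> B"
  shows "integrable train (T b)" "integrable train (\<lambda>X. (T b X)^2)"
    "(\<integral>X. T b X \<partial>train) = n * v b"
    "(\<integral>X. (T b X)^2 \<partial>train) = n * L^2 * v b + n^2 * (v b)^2 - n * (v b)^2"
proof -
  have i: "integrable P (\<lambda>x. (b \<bullet> (R *v x))^2)" "integrable P (\<lambda>x. ((b \<bullet> (R *v x))^2)^2)"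
    by (intro integrable_P; measurable)+
  have e: "(\<integral>x. (b \<bullet> (R *v x))^2 \<partial>P) = v b" "(\<integral>x. (b \<bullet> (R *v x))^4 \<partial>P) = L^2 * v b"
    using moment_P[OF b, of 2] moment_P[OF b, of 4] L
    by (simp_all add: power2_eq_square power4_eq_xxxx)
  note m = product_sum_moments[of "{..<n}" "\<lambda>_. P" "\<lambda>_ x. (b \<bullet> (R *v x))^2",
      OF finite_lessThan prob_P i]
  show "integrable train (T b)" "integrable train (\<lambda>X. (T b X)^2)"
    "(\<integral>X. T b X \<partial>train) = n * v b"
    "(\<integral>X. (T b X)^2 \<partial>train) = n * L^2 * v b + n^2 * (v b)^2 - n * (v b)^2"
    using m by (auto simp: e power_mult_distrib T_def[abs_def])
qed

lemma shrinkage_integrable: "s \<ge> 0 \<Longrightarrow> integrable train (\<lambda>X. shrinkage s (T b X))"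
  by (intro train.integrable_const_bound[where B = 1]) (auto simp: shrinkage_bounds T_nonneg)

text \<open>Integrating the tangent bound leaves only the first two moments of \<open>T b\<close>,
  so its full distribution never enters.\<close>

lemma shrinkage_gap:
  assumes b: "b \<in> B" and s: "s \<ge> 0"
  shows "s * (n * v b) / ((L^2 + n * v b) * (s + (L^2 + n * v b)))
     \<le> (\<integral>X. shrinkage s (T b X) \<partial>train) - (\<integral>X. shrinkage 0 (T b X) \<partial>train)"
proof -
  define c where "c = L^2 + n * v b"
  have c: "c > 0" using L v[OF b] by (simp add: c_def add_pos_nonneg)
  define w where "w = (s + 2 * c) / (c * (s + c))^2"
  have w: "w \<ge> 0" using s c by (simp add: w_def)
  note m = T_moments[OF b]
  have "(\<integral>X. s * (T b X / (c * (s + c)) - w * ((T b X)^2 - c * T b X)) \<partial>train)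
     \<le> (\<integral>X. shrinkage s (T b X) - shrinkage 0 (T b X) \<partial>train)"
    unfolding w_def
    by (intro integral_mono integrable_mult_right Bochner_Integration.integrable_diff integrable_divide m
          shrinkage_integrable shrinkage_tangent T_nonneg s c order_refl)
  also have "\<dots> = (\<integral>X. shrinkage s (T b X) \<partial>train) - (\<integral>X. shrinkage 0 (T b X) \<partial>train)"
    using s by (intro Bochner_Integration.integral_diff shrinkage_integrable) auto
  also have "(\<integral>X. s * (T b X / (c * (s + c)) - w * ((T b X)^2 - c * T b X)) \<partial>train)
      = s * (n * v b / (c * (s + c)) - w * (n * L^2 * v b + n^2 * (v b)^2 - n * (v b)^2 - c * (n * v b)))"
    using m by simp
  also have "\<dots> = s * (n * v b) / (c * (s + c)) + s * (w * (n * (v b)^2))"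
    by (simp add: c_def algebra_simps power2_eq_square)
  finally have "s * (n * v b) / (c * (s + c)) + s * (w * (n * (v b)^2))
     \<le> (\<integral>X. shrinkage s (T b X) \<partial>train) - (\<integral>X. shrinkage 0 (T b X) \<partial>train)" .
  moreover have "0 \<le> s * (w * (n * (v b)^2))" using s w by simp
  ultimately show ?thesis unfolding c_def by linarith
qed

lemma nn_integral_weighted_shrinkage:
  assumes s: "s \<ge> 0"
  shows "(\<integral>\<^sup>+X. ennreal ((\<Sum>b\<in>B. v b * shrinkage s (T b X)) + s) \<partial>train)
    = ennreal ((\<Sum>b\<in>B. v b * (\<integral>X. shrinkage s (T b X) \<partial>train)) + s)"
proof -
  have "(\<integral>\<^sup>+X. ennreal ((\<Sum>b\<in>B. v b * shrinkage s (T b X)) + s) \<partial>train)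
     = ennreal (\<integral>X. (\<Sum>b\<in>B. v b * shrinkage s (T b X)) + s \<partial>train)"
    using s v shrinkage_integrable
    by (intro nn_integral_eq_integral)
       (auto intro!: sum_nonneg mult_nonneg_nonneg add_nonneg_nonneg simp: less_imp_le shrinkage_bounds T_nonneg)
  also have "(\<integral>X. (\<Sum>b\<in>B. v b * shrinkage s (T b X)) + s \<partial>train)
     = (\<Sum>b\<in>B. v b * (\<integral>X. shrinkage s (T b X) \<partial>train)) + s"
    using s shrinkage_integrable by (simp add: Bochner_Integration.integral_sum train.prob_space)
  finally show ?thesis .
qed

section \<open>Lower bound for all linear rules and the exact noiseless risk of one rule\<close>

lemma nn_integral_P_real:
  assumes "f \<in> borel_measurable borel" "\<And>x. f x \<ge> 0"
  shows "(\<integral>\<^sup>+x. ennreal (f x) \<partial>P) = ennreal ((\<Sum>b\<in>B. v b / L^2 * f (g b)) + (1 - (\<Sum>b\<in>B. v b / L^2)) * f 0)"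
  using nn_integral_eq_integral[OF integrable_P[OF assms(1)]] integral_P[OF assms(1)] assms(2) by simp

text \<open>For fixed \<open>X\<close> and \<open>u\<close>, a test point at \<open>g b\<close>
  involves only the weights \<open>l i (g b) X u\<close>. Projecting the error onto \<open>b\<close>
  reduces it to one-dimensional ridge regression, and the mass \<open>v b / L^2\<close> cancels the
  factor \<open>L^2\<close> of that bound.\<close>

lemma average_risk_lower:
  assumes \<nu>: "prob_space \<nu>" "sets \<nu> = sets borel" "\<And>i j. integrable \<nu> (\<lambda>\<theta>. \<theta> $ i * \<theta> $ j)"
    and R: "R = msqrt (second_moment \<nu>)" and N: "noise_kernel N s" and l: "linear_rule n mu l"
  shows "ennreal ((\<Sum>b\<in>B. v b * (\<integral>X. shrinkage s (T b X) \<partial>train)) + s)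
     \<le> (\<integral>\<^sup>+\<theta>. expected_risk n P N mu l \<theta> \<partial>\<nu>)"
proof -
  have s: "s \<ge> 0" using noise_average(3)[OF N] .
  interpret mu: prob_space mu using l by (simp add: linear_rule_def)
  have "ennreal ((\<Sum>b\<in>B. v b * (\<integral>X. shrinkage s (T b X) \<partial>train)) + s)
     = (\<integral>\<^sup>+X. \<integral>\<^sup>+u. ennreal ((\<Sum>b\<in>B. v b * shrinkage s (T b X)) + s) \<partial>mu \<partial>train)"
    using s by (simp add: nn_integral_weighted_shrinkage mu.emeasure_space_1)
  also have "\<dots> \<le> (\<integral>\<^sup>+X. \<integral>\<^sup>+u. \<integral>\<^sup>+x. ennreal ((norm (R *v x - (\<Sum>i<n. l i x X u *\<^sub>R (R *v X i))))^2
      + s * (\<Sum>i<n. (l i x X u)^2) + s) \<partial>P \<partial>mu \<partial>train)"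
  proof (intro nn_integral_mono)
    fix X u assume "X \<in> space train"
    hence X: "X \<in> space (PiM {..<n} (\<lambda>_. borel :: (real^'n) measure))"
      using sets_eq_imp_space_eq[OF sets_train] by simp
    have [measurable]: "(\<lambda>x. l i x X u) \<in> borel_measurable borel" if "i \<in> {..<n}" for i
      using that X by (intro linear_rule_measurable[OF l]) auto
    define f where "f x = (norm (R *v x - (\<Sum>i<n. l i x X u *\<^sub>R (R *v X i))))^2 + s * (\<Sum>i<n. (l i x X u)^2) + s" for x
    have f: "f \<in> borel_measurable borel" unfolding f_def by measurable
    have f0: "f x \<ge> s" for x using s by (simp add: f_def sum_nonneg)
    have fb: "L^2 * shrinkage s (T b X) + s \<le> f (g b)" if b: "b \<in> B" for b
    proof -
      let ?z = "R *v g b - (\<Sum>i<n. l i (g b) X u *\<^sub>R (R *v X i))"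
      have "b \<bullet> ?z = L - (\<Sum>i<n. l i (g b) X u * (b \<bullet> (R *v X i)))"
        using b by (simp add: Rg inner_diff_right inner_sum_right orth)
      hence "L^2 * shrinkage s (T b X) \<le> (b \<bullet> ?z)^2 + s * (\<Sum>i<n. (l i (g b) X u)^2)"
        unfolding T_def using ridge_lower_bound[OF s] by simp
      moreover have "(b \<bullet> ?z)^2 \<le> (norm ?z)^2"
        using Cauchy_Schwarz_ineq[of b ?z] orth[OF b b] by (simp add: power2_norm_eq_inner)
      ultimately show ?thesis by (simp add: f_def)
    qed
    \<comment> \<open>The masses, including that of the origin, add up to 1, so the irreducible term
      \<open>s\<close> is spread over all atoms.\<close>
    have "(\<Sum>b\<in>B. v b * shrinkage s (T b X)) + s
       = (\<Sum>b\<in>B. v b / L^2 * (L^2 * shrinkage s (T b X) + s)) + (1 - (\<Sum>b\<in>B. v b / L^2)) * s"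
      using L by (simp add: distrib_left sum.distrib sum_distrib_left algebra_simps)
    also have "\<dots> \<le> (\<Sum>b\<in>B. v b / L^2 * f (g b)) + (1 - (\<Sum>b\<in>B. v b / L^2)) * f 0"
      using v sum_p by (intro add_mono sum_mono mult_left_mono fb f0) (auto simp: less_imp_le)
    finally show "ennreal ((\<Sum>b\<in>B. v b * shrinkage s (T b X)) + s)
      \<le> (\<integral>\<^sup>+x. ennreal ((norm (R *v x - (\<Sum>i<n. l i x X u *\<^sub>R (R *v X i))))^2 + s * (\<Sum>i<n. (l i x X u)^2) + s) \<partial>P)"
      unfolding f_def[symmetric] using nn_integral_P_real[OF f order_trans[OF s f0]] by (simp add: ennreal_leI)
  qed
  also have "\<dots> = (\<integral>\<^sup>+\<theta>. expected_risk n P N mu l \<theta> \<partial>\<nu>)"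
    unfolding R by (rule average_risk_eq[symmetric, OF prob_P sets_P N l \<nu>])
  finally show ?thesis .
qed

text \<open>The averaging rule on the atoms \<open>g b\<close>: if the test point is \<open>g b\<close>, all training points equal to
  it receive the same weight.\<close>

definition interpolation :: "nat \<Rightarrow> real^'n \<Rightarrow> (nat \<Rightarrow> real^'n) \<Rightarrow> real \<Rightarrow> real" where
  "interpolation i x X u = L^2 * ((R *v x) \<bullet> (R *v X i)) / (\<Sum>k<n. ((R *v x) \<bullet> (R *v X k))^2)"

lemma linear_rule_interpolation: "linear_rule n (return borel 0) interpolation"
proof -
  have "(\<lambda>(x, Xs, u). interpolation i x Xs u) \<in>
        borel_measurable (borel \<Otimes>\<^sub>M (PiM {..<n} (\<lambda>_. borel) \<Otimes>\<^sub>M return borel 0))" (is "_ \<in> borel_measurable ?M")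
    if "i < n" for i
  proof -
    have [measurable]: "(\<lambda>p. fst (snd p) k) \<in> borel_measurable ?M" if "k \<in> {..<n}" for k
      using that by measurable
    have [measurable]: "i \<in> {..<n}" using that by simp
    show ?thesis unfolding interpolation_def case_prod_beta' by measurable
  qed
  thus ?thesis by (simp add: linear_rule_def prob_space_return)
qed

text \<open>A training atom along another eigenvector is orthogonal to \<open>b\<close> and gets
  weight 0, so the prediction is exact as soon as \<open>g b\<close> has been sampled up to the
  kernel of \<open>R\<close>.\<close>

lemma interpolation_error:
  assumes b: "b \<in> B" and X: "\<And>i. i < n \<Longrightarrow> R *v X i = 0 \<or> (\<exists>a\<in>B. R *v X i = L *\<^sub>R a)"
  shows "(norm (R *v g b - (\<Sum>i<n. interpolation i (g b) X u *\<^sub>R (R *v X i))))^2 = L^2 * shrinkage 0 (T b X)"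
proof -
  have den: "(\<Sum>k<n. ((R *v g b) \<bullet> (R *v X k))^2) = L^2 * T b X"
    by (simp add: Rg[OF b] T_def sum_distrib_left power_mult_distrib)
  have "interpolation i (g b) X u *\<^sub>R (R *v X i) = (L * (b \<bullet> (R *v X i))^2 / T b X) *\<^sub>R b" if "i < n" for i
    unfolding interpolation_def den using X[OF that] L b
    by (auto simp: Rg orth power2_eq_square)
  hence "(\<Sum>i<n. interpolation i (g b) X u *\<^sub>R (R *v X i)) = (\<Sum>i<n. L * (b \<bullet> (R *v X i))^2 / T b X) *\<^sub>R b"
    by (simp add: scaleR_sum_left)
  \<comment> \<open>The quotient is left uncancelled: for \<open>T b X = 0\<close> it is 0 in HOL,
    and the whole error \<open>L *\<^sub>R b\<close> remains.\<close>
  also have "(\<Sum>i<n. L * (b \<bullet> (R *v X i))^2 / T b X) = L * T b X / T b X"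
    by (simp add: T_def sum_distrib_left sum_divide_distrib)
  also have "R *v g b - (L * T b X / T b X) *\<^sub>R b = (L * shrinkage 0 (T b X)) *\<^sub>R b"
    by (simp add: Rg[OF b] shrinkage_def)
  finally have "R *v g b - (\<Sum>i<n. interpolation i (g b) X u *\<^sub>R (R *v X i)) = (L * shrinkage 0 (T b X)) *\<^sub>R b"
    by simp
  moreover have "norm b = 1" using orth[OF b b] by (simp add: norm_eq_1)
  ultimately show ?thesis by (simp add: power_mult_distrib shrinkage_def)
qed

lemma average_risk_interpolation:
  assumes \<nu>: "prob_space \<nu>" "sets \<nu> = sets borel" "\<And>i j. integrable \<nu> (\<lambda>\<theta>. \<theta> $ i * \<theta> $ j)"
    and R: "R = msqrt (second_moment \<nu>)"
  shows "(\<integral>\<^sup>+\<theta>. expected_risk n P (\<lambda>x. return borel 0) (return borel 0) interpolation \<theta> \<partial>\<nu>)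
    = ennreal (\<Sum>b\<in>B. v b * (\<integral>X. shrinkage 0 (T b X) \<partial>train))"
proof -
  interpret mu: prob_space "return borel (0::real)" by (simp add: prob_space_return)
  have "noise_kernel (\<lambda>x::real^'n. return borel 0) 0"
    by (auto simp: noise_kernel_def prob_space_return integral_return space_subprob_algebra
        integrable_iff_bounded nn_integral_return
        intro!: measurable_const prob_space_imp_subprob_space)
  note avg = average_risk_eq[OF prob_P sets_P this linear_rule_interpolation \<nu>, folded R]
  \<comment> \<open>The error formula needs training points on the atoms, which holds almost surely
    under the design.\<close>
  have ae: "AE X in train. \<forall>i\<in>{..<n}. R *v X i = 0 \<or> (\<exists>a\<in>B. R *v X i = L *\<^sub>R a)"
  proof (intro AE_finite_allI finite_lessThan AE_PiM_component prob_P AE_P)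
    have "{x. R *v x = 0 \<or> (\<exists>a\<in>B. R *v x = L *\<^sub>R a)}
        = (\<lambda>x. R *v x) -` insert 0 ((\<lambda>a. L *\<^sub>R a) ` B) \<inter> space borel" by auto
    also have "\<dots> \<in> sets borel"
      using fin by (intro measurable_sets[OF R_measurable] borel_closed finite_imp_closed) auto
    finally show "{x. R *v x = 0 \<or> (\<exists>a\<in>B. R *v x = L *\<^sub>R a)} \<in> sets borel" .
  qed (auto simp: Rg)
  have "(\<integral>\<^sup>+\<theta>. expected_risk n P (\<lambda>x. return borel 0) (return borel 0) interpolation \<theta> \<partial>\<nu>)
    = (\<integral>\<^sup>+X. \<integral>\<^sup>+u. \<integral>\<^sup>+x. ennreal ((norm (R *v x - (\<Sum>i<n. interpolation i x X u *\<^sub>R (R *v X i))))^2)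
        \<partial>P \<partial>return borel 0 \<partial>train)"
    unfolding avg by simp
  also have "\<dots> = (\<integral>\<^sup>+X. \<integral>\<^sup>+u. ennreal (\<Sum>b\<in>B. v b * shrinkage 0 (T b X)) \<partial>return borel (0::real) \<partial>train)"
  proof (rule nn_integral_cong_AE, rule AE_mp[OF ae], intro AE_I2 impI nn_integral_cong)
    fix X and u :: real
    assume "X \<in> space train" and X: "\<forall>i\<in>{..<n}. R *v X i = 0 \<or> (\<exists>a\<in>B. R *v X i = L *\<^sub>R a)"
    define f where "f x = (norm (R *v x - (\<Sum>i<n. interpolation i x X u *\<^sub>R (R *v X i))))^2" for x
    have f: "f \<in> borel_measurable borel" unfolding f_def interpolation_def by measurable
    \<comment> \<open>Without noise a test point at the origin is predicted exactly, so the leftover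
      mass costs nothing.\<close>
    have "f 0 = 0" by (simp add: f_def interpolation_def)
    moreover have "f (g b) = L^2 * shrinkage 0 (T b X)" if "b \<in> B" for b
      unfolding f_def using that X by (intro interpolation_error) auto
    ultimately show "(\<integral>\<^sup>+x. ennreal ((norm (R *v x - (\<Sum>i<n. interpolation i x X u *\<^sub>R (R *v X i))))^2) \<partial>P)
       = ennreal (\<Sum>b\<in>B. v b * shrinkage 0 (T b X))"
      unfolding f_def[symmetric] using L by (subst nn_integral_P_real[OF f]) (auto simp: f_def)
  qed
  also have "\<dots> = ennreal (\<Sum>b\<in>B. v b * (\<integral>X. shrinkage 0 (T b X) \<partial>train))"
    using nn_integral_weighted_shrinkage[of 0] by (simp add: mu.emeasure_space_1)
  finally show ?thesis .
qed

text \<open>The noisy infimum is bounded below uniformly over rules, while for the noiseless one,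
  which is subtracted, the single rule \<open>interpolation\<close> suffices as an upper
  bound.\<close>

lemma Ebar_gap:
  assumes \<nu>: "prob_space \<nu>" "sets \<nu> = sets borel" "\<And>i j. integrable \<nu> (\<lambda>\<theta>. \<theta> $ i * \<theta> $ j)"
    and R: "R = msqrt (second_moment \<nu>)" and N: "noise_kernel N s"
  shows "ereal (\<Sum>b\<in>B. v b * (s * (n * v b) / ((L^2 + n * v b) * (s + (L^2 + n * v b)))))
    \<le> Ebar n \<nu> P N s - Ebar n \<nu> P (\<lambda>x. return borel 0) 0"
proof -
  have s: "s \<ge> 0" using noise_average(3)[OF N] .
  let ?A = "\<lambda>s. \<Sum>b\<in>B. v b * (\<integral>X. shrinkage s (T b X) \<partial>train)"
  have A: "?A s \<ge> 0" if "s \<ge> 0" for s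
    using that v by (intro sum_nonneg mult_nonneg_nonneg integral_nonneg_AE) (auto simp: less_imp_le shrinkage_bounds T_nonneg)
  have "ennreal (?A s + s) \<le> (INF r \<in> {(mu, l). linear_rule n mu l}. \<integral>\<^sup>+ \<theta>. expected_risk n P N (fst r) (snd r) \<theta> \<partial>\<nu>)"
    using average_risk_lower[OF \<nu> R N] by (intro INF_greatest) auto
  hence "ereal (?A s + s) \<le> enn2ereal (INF r \<in> {(mu, l). linear_rule n mu l}. \<integral>\<^sup>+ \<theta>. expected_risk n P N (fst r) (snd r) \<theta> \<partial>\<nu>)"
    using A[OF s] s by (simp add: less_eq_ennreal.rep_eq enn2ereal_ennreal del: ennreal_plus)
  hence "ereal (?A s + s) - ereal s \<le> Ebar n \<nu> P N s"
    unfolding Ebar_def by (rule ereal_minus_mono) simp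
  hence lower: "ereal (?A s) \<le> Ebar n \<nu> P N s" by simp
  have "(INF r \<in> {(mu, l). linear_rule n mu l}. \<integral>\<^sup>+ \<theta>. expected_risk n P (\<lambda>x. return borel 0) (fst r) (snd r) \<theta> \<partial>\<nu>)
     \<le> ennreal (?A 0)"
    using linear_rule_interpolation average_risk_interpolation[OF \<nu> R]
    by (intro INF_lower2[where i = "(return borel 0, interpolation)"]) auto
  hence "enn2ereal (INF r \<in> {(mu, l). linear_rule n mu l}. \<integral>\<^sup>+ \<theta>. expected_risk n P (\<lambda>x. return borel 0) (fst r) (snd r) \<theta> \<partial>\<nu>)
     \<le> ereal (?A 0)"
    using A[of 0] by (simp add: less_eq_ennreal.rep_eq enn2ereal_ennreal)
  hence upper: "Ebar n \<nu> P (\<lambda>x. return borel 0) 0 \<le> ereal (?A 0)"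
    unfolding Ebar_def by (simp add: zero_ereal_def[symmetric])
  have "(\<Sum>b\<in>B. v b * (s * (n * v b) / ((L^2 + n * v b) * (s + (L^2 + n * v b))))) 
     \<le> (\<Sum>b\<in>B. v b * ((\<integral>X. shrinkage s (T b X) \<partial>train) - (\<integral>X. shrinkage 0 (T b X) \<partial>train)))"
    using v s by (intro sum_mono mult_left_mono shrinkage_gap) (auto simp: less_imp_le)
  hence "ereal (\<Sum>b\<in>B. v b * (s * (n * v b) / ((L^2 + n * v b) * (s + (L^2 + n * v b)))))
    \<le> ereal (?A s) - ereal (?A 0)"
    by (simp add: right_diff_distrib sum_subtractf)
  also have "\<dots> \<le> Ebar n \<nu> P N s - Ebar n \<nu> P (\<lambda>x. return borel 0) 0"
    by (rule ereal_minus_mono[OF lower upper])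
  finally show ?thesis .
qed

end

subsection \<open>Constraints imposed by the class of covariate laws\<close>

text \<open>Taking traces in the fourth-moment condition bounds the mean of
  \<open>(norm (msqrt H *v x))^4\<close> by \<open>L2 * trace S\<close>; by nonnegativity of the
  variance that mean is at least \<open>(trace S)^2\<close>. This makes the masses of the extremal
  design sum to at most 1.\<close>

lemma cov_class_trace:
  assumes Q: "Q \<in> cov_class H S L2" and "L2 \<ge> 0"
  shows "trace S \<le> L2"
proof -
  let ?R = "msqrt H"
  interpret prob_space Q using Q by (simp add: cov_class_def)
  define y where "y x = (norm (?R *v x))^2" for x
  have i2: "integrable Q (\<lambda>x. (?R *v x)$i * (?R *v x)$j)" for i j using Q by (simp add: cov_class_def)
  have i4: "integrable Q (\<lambda>x. y x * ((?R *v x)$i * (?R *v x)$j))" for i j using Q by (simp add: cov_class_def y_def)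
  have S: "S = (\<chi> i j. \<integral>x. (?R *v x)$i * (?R *v x)$j \<partial>Q)" using Q by (simp add: cov_class_def)
  define M where "M = (\<chi> i j. \<integral>x. y x * ((?R *v x)$i * (?R *v x)$j) \<partial>Q)"
  have "psd (L2 *\<^sub>R S - M)" using Q by (simp add: cov_class_def loewner_le_def M_def y_def)
  hence "0 \<le> axis i 1 \<bullet> ((L2 *\<^sub>R S - M) *v axis i 1)" for i by (simp add: psd_def)
  hence "M $ i $ i \<le> L2 * S $ i $ i" for i
    by (simp add: matrix_vector_mult_basis column_def inner_axis')
  hence tr: "trace M \<le> L2 * trace S" by (simp add: trace_def sum_distrib_left sum_mono)
  have y: "y x = (\<Sum>i\<in>UNIV. (?R *v x)$i * (?R *v x)$i)" for x
    by (simp add: y_def dot_square_norm[symmetric] inner_vec_def)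
  have y2: "(y x)^2 = (\<Sum>i\<in>UNIV. y x * ((?R *v x)$i * (?R *v x)$i))" for x
    unfolding power2_eq_square sum_distrib_left[symmetric] y[symmetric] ..
  have iy: "integrable Q y" "integrable Q (\<lambda>x. (y x)^2)"
    unfolding y2 by (simp_all add: y[abs_def] i2 i4[unfolded y])
  have t: "expectation y = trace S" "expectation (\<lambda>x. (y x)^2) = trace M"
    unfolding y2 by (simp_all add: i4 trace_def M_def) (simp add: y[abs_def] i2 S)
  have "0 \<le> expectation (\<lambda>x. (y x - trace S)^2)" by simp
  hence "(trace S)^2 \<le> trace M" using variance_eq[OF iy] unfolding t by linarith
  hence "trace S * trace S \<le> L2 * trace S" using tr by (simp add: power2_eq_square)
  thus ?thesis using \<open>L2 \<ge> 0\<close> by (cases "trace S > 0") (auto simp: mult_le_cancel_right)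
qed

text \<open>The part \<open>q\<close> of \<open>b\<close> orthogonal to the range of
  \<open>msqrt H\<close> is annihilated by the second moment of the transformed covariate, so
  \<open>c * (q \<bullet> b) = 0\<close> and \<open>q\<close> vanishes. This supplies the preimages
  \<open>g b\<close>.\<close>

lemma cov_class_range:
  fixes H S :: "real^'n^'n"
  assumes Q: "Q \<in> cov_class H S L2" and b: "S *v b = c *\<^sub>R b" "c \<noteq> 0"
  shows "\<exists>x. msqrt H *v x = b"
proof -
  let ?R = "msqrt H"
  have span: "span (range ((*v) ?R)) = range ((*v) ?R)"
    by (simp add: span_eq_iff linear_subspace_image)
  obtain p q where pq: "p \<in> range ((*v) ?R)" "\<And>w. w \<in> range ((*v) ?R) \<Longrightarrow> orthogonal q w" "b = p + q"
    using orthogonal_subspace_decomp_exists[of "range ((*v) ?R)" b] unfolding span by metis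
  have q0: "q \<bullet> (?R *v x) = 0" for x using pq(2) by (auto simp: orthogonal_def)
  have i2: "integrable Q (\<lambda>x. 1 * ((?R *v x)$i * (?R *v x)$j))" for i j using Q by (simp add: cov_class_def)
  have S: "S = (\<chi> i j. \<integral>x. 1 * ((?R *v x)$i * (?R *v x)$j) \<partial>Q)" using Q by (simp add: cov_class_def)
  have "q \<bullet> (S *v b) = 0"
    using moment_form(2)[OF i2, of q b, folded S] by (simp add: q0)
  hence "q \<bullet> b = 0" using b by simp
  moreover have "q \<bullet> p = 0" using pq(1) q0 by auto
  ultimately have "q \<bullet> q = 0" by (simp add: pq(3) inner_add_right)
  thus ?thesis using pq by auto
qed

text \<open>All nonzero transformed atoms have norm \<open>L\<close>, so the fourth-moment matrix
  equals \<open>L^2 *\<^sub>R S\<close> and the Loewner constraint holds with equality.\<close>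

lemma (in eigen_design) P_in_cov_class:
  assumes R: "R = msqrt H" and S: "\<And>x. S *v x = (\<Sum>b\<in>B. v b *\<^sub>R (x \<bullet> b) *\<^sub>R b)"
  shows "P \<in> cov_class H S (L^2)"
proof -
  have [measurable]: "(\<lambda>x. (R *v x) $ i) \<in> borel_measurable borel" for i
    by (rule measurable_compose[OF R_measurable borel_measurable_continuous_onI]) (intro continuous_intros)
  have S': "S $ i $ j = (\<Sum>b\<in>B. v b * (b $ i * b $ j))" for i j
  proof -
    have "S $ i $ j = (S *v axis j 1) $ i" by (simp add: matrix_vector_mult_basis column_def)
    thus ?thesis by (simp add: S inner_axis' mult.commute mult.left_commute)
  qed
  have m2: "(\<integral>x. (R *v x)$i * (R *v x)$j \<partial>P) = S $ i $ j" for i j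
    using L by (subst integral_P) (auto simp: S' Rg power2_eq_square intro!: sum.cong)
  have nb: "norm b = 1" if "b \<in> B" for b using orth[OF that that] by (simp add: norm_eq_1)
  have m4: "(\<integral>x. (norm (R *v x))^2 * ((R *v x)$i * (R *v x)$j) \<partial>P) = L^2 * S $ i $ j" for i j
    using L by (subst integral_P) (auto simp: S' Rg nb power2_eq_square sum_distrib_left intro!: sum.cong)
  have z: "L^2 *\<^sub>R S - (\<chi> i j. \<integral>x. (norm (R *v x))^2 * ((R *v x)$i * (R *v x)$j) \<partial>P) = 0"
    by (simp add: vec_eq_iff m4)
  have "loewner_le (\<chi> i j. \<integral>x. (norm (R *v x))^2 * ((R *v x)$i * (R *v x)$j) \<partial>P) (L^2 *\<^sub>R S)"
    unfolding loewner_le_def z by (simp add: psd_def transpose_def vec_eq_iff)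
  moreover have "(\<chi> i j. \<integral>x. (R *v x)$i * (R *v x)$j \<partial>P) = S" by (simp add: vec_eq_iff m2)
  ultimately show ?thesis unfolding cov_class_def R[symmetric]
    using prob_P sets_P by (auto intro!: integrable_P)
qed

text \<open>The contribution of one eigenvalue \<open>v\<close> to the claimed bound, matched with
  the form produced by \<open>Ebar_gap\<close>.\<close>

lemma df1_gap_term:
  fixes v s L n :: real
  assumes "v \<ge> 0" "s \<ge> 0" "L > 0" "n > 0"
  shows "(s / n + L^2 / n) * (v / (v + (s / n + L^2 / n))) - (L^2 / n) * (v / (v + L^2 / n))
    = v * (s * (n * v) / ((L^2 + n * v) * (s + (L^2 + n * v))))"
proof -
  define M where "M = L^2"
  have M: "M > 0" using assms by (simp add: M_def)
  have 1: "(s / n + M / n) * (v / (v + (s / n + M / n))) = (s + M) * v / (n * v + s + M)"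
    using assms M by (simp add: divide_simps) (simp add: algebra_simps)
  have 2: "(M / n) * (v / (v + M / n)) = M * v / (n * v + M)"
    using assms M by (simp add: divide_simps) (simp add: algebra_simps)
  have p: "n * v + s + M > 0" "n * v + M > 0" using assms M by (simp_all add: add_nonneg_pos)
  show ?thesis unfolding M_def[symmetric] 1 2 using p
    by (simp add: divide_simps) (simp add: algebra_simps power2_eq_square)
qed

text \<open>The supremum is bounded below by its value at one member of the class. Nonemptiness is
  assumed because a supremum over the empty set is minus infinity in \<open>ereal\<close>; the
  noiseless model is the kernel of point masses at 0.\<close>

theorem theorem3:
  fixes \<sigma>2 LH :: real and n :: nat and \<nu> :: "(real^'d::finite) measure"
    and A SigmaH :: "real^'d^'d" and N :: "real^'d \<Rightarrow> real measure"
  assumes "\<sigma>2 \<ge> 0" and "LH > 0" and "n \<ge> 1"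
    and "prob_space \<nu>" and "sets \<nu> = sets borel"
    and "psd A" and "AE \<theta> in \<nu>. norm (A *v \<theta>) = 1"
    and "\<forall>i j. integrable \<nu> (\<lambda>\<theta>. \<theta>$i * \<theta>$j)"
    and "psd SigmaH"
    and "noise_kernel N \<sigma>2"
    and "cov_class (second_moment \<nu>) SigmaH (LH^2) \<noteq> {}"
  shows "ereal ((\<sigma>2 / n + LH^2 / n) * df1 SigmaH (\<sigma>2 / n + LH^2 / n)
                 - (LH^2 / n) * df1 SigmaH (LH^2 / n))
         \<le> (SUP P \<in> cov_class (second_moment \<nu>) SigmaH (LH^2).
               Ebar n \<nu> P N \<sigma>2 - Ebar n \<nu> P (\<lambda>x. return borel 0) 0)"
proof -
  let ?H = "second_moment \<nu>"
  obtain Q where Q: "Q \<in> cov_class ?H SigmaH (LH^2)" using assms(11) by blast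
  obtain B0 where B0: "eigenbasis SigmaH B0" using assms(9) eigenbasis_exists psd_def by metis
  define v where "v b = b \<bullet> (SigmaH *v b)" for b
  \<comment> \<open>Directions with eigenvalue 0 are discarded: they may lie outside the range of
    the square root, and they contribute nothing to the sums over \<open>B0\<close>.\<close>
  define B where "B = {b\<in>B0. v b \<noteq> 0}"
  have v0: "v b \<ge> 0" for b using assms(9) by (simp add: psd_def v_def)
  have fin: "finite B0" using B0 by (simp add: eigenbasis_def)
  have restrict: "(\<Sum>b\<in>B. k b) = (\<Sum>b\<in>B0. k b)" if "\<And>b. v b = 0 \<Longrightarrow> k b = 0"
    for k :: "real^'d \<Rightarrow> 'z::comm_monoid_add"
    using fin that by (intro sum.mono_neutral_left) (auto simp: B_def)
  have "\<exists>x. msqrt ?H *v x = LH *\<^sub>R b" if b: "b \<in> B" for b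
  proof -
    have "SigmaH *v b = v b *\<^sub>R b" "v b \<noteq> 0" using b B0 by (auto simp: B_def eigenbasis_def v_def)
    then obtain x where "msqrt ?H *v x = b" using cov_class_range[OF Q] by blast
    thus ?thesis by (intro exI[of _ "LH *\<^sub>R x"]) (simp add: matrix_vector_mult_scaleR)
  qed
  then obtain g where g: "\<And>b. b \<in> B \<Longrightarrow> msqrt ?H *v g b = LH *\<^sub>R b" by metis
  have "sum v B = trace SigmaH"
    using restrict[of v] trace_eigenbasis[OF B0, of SigmaH] by (simp add: v_def)
  interpret eigen_design B v LH "msqrt ?H" g n
  proof
    show "a \<bullet> b = (if a = b then 1 else 0)" if "a \<in> B" "b \<in> B" for a b
      using that eigenbasis_inner[OF B0, of a b] by (auto simp: B_def)
    show "v b > 0" if "b \<in> B" for b using that v0[of b] by (simp add: B_def)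
    show "sum v B \<le> LH^2" using cov_class_trace[OF Q] \<open>sum v B = trace SigmaH\<close> by simp
  qed (use fin g assms(2) in \<open>auto simp: B_def\<close>)
  have P: "P \<in> cov_class ?H SigmaH (LH^2)"
  proof (rule P_in_cov_class[OF refl])
    show "SigmaH *v x = (\<Sum>b\<in>B. v b *\<^sub>R (x \<bullet> b) *\<^sub>R b)" for x
      using restrict[of "\<lambda>b. v b *\<^sub>R (x \<bullet> b) *\<^sub>R b"] eigenbasis_apply[OF B0, of x] by (simp add: v_def)
  qed
  have pos: "\<sigma>2 / n + LH^2 / n > 0" "LH^2 / n > 0" using assms(1-3) by (simp_all add: add_nonneg_pos)
  have "(\<sigma>2 / n + LH^2 / n) * df1 SigmaH (\<sigma>2 / n + LH^2 / n) - (LH^2 / n) * df1 SigmaH (LH^2 / n)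
     = (\<Sum>b\<in>B0. (\<sigma>2 / n + LH^2 / n) * (v b / (v b + (\<sigma>2 / n + LH^2 / n))) - (LH^2 / n) * (v b / (v b + LH^2 / n)))"
    unfolding df1_eigenbasis[OF assms(9) B0 pos(1)] df1_eigenbasis[OF assms(9) B0 pos(2)] v_def[symmetric]
    by (simp only: sum_distrib_left sum_subtractf)
  also have "\<dots> = (\<Sum>b\<in>B0. v b * (\<sigma>2 * (n * v b) / ((LH^2 + n * v b) * (\<sigma>2 + (LH^2 + n * v b)))))"
    using assms(1-3) v0 by (intro sum.cong refl df1_gap_term) auto
  also have "\<dots> = (\<Sum>b\<in>B. v b * (\<sigma>2 * (n * v b) / ((LH^2 + n * v b) * (\<sigma>2 + (LH^2 + n * v b)))))"
    by (rule restrict[symmetric]) simp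
  finally have "ereal ((\<sigma>2 / n + LH^2 / n) * df1 SigmaH (\<sigma>2 / n + LH^2 / n) - (LH^2 / n) * df1 SigmaH (LH^2 / n))
     \<le> Ebar n \<nu> P N \<sigma>2 - Ebar n \<nu> P (\<lambda>x. return borel 0) 0"
    using Ebar_gap[OF assms(4,5) _ refl assms(10)] assms(8) by simp
  thus ?thesis using P by (intro SUP_upper2)
qed

end
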